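(* There is an absolute constant $c>0$ such that the following holds. Let $2<q\le 3$ and let $\mu$ be a Borel probability measure on $\mathbb R$ with $\beta_q=\int_{\mathbb R}|u|^q\,\mu(du)<\infty$, $m_1=0$, $m_2=1$. Let $X_1,X_2,\dots$ be free random variables, each with distribution $\mu$, and let $F_n$ be the distribution function of $Y_n=(X_1+\dots+X_n)/\sqrt n$. Then, for every $n\in\mathbb N$, $$\sup_{x\in\mathbb R}|F_n(x)-w(x)|\le c\,L_{qn}.$$
   Context: For a probability measure $\mu$ on $\mathbb R$: $m_k=\int u^k\,\mu(du)$ and $\beta_q=\int|u|^q\,\mu(du)$. If $X_1,\dots,X_n$ are free with common distribution $\mu$, the distribution of $X_1+\dots+X_n$ is the $n$-fold free additive convolution $\mu^{n\boxplus}=\mu\boxplus\dots\boxplus\mu$ (defined for arbitrary probability measures on $\mathbb R$). Thus $F_n(x)=\mu^{n\boxplus}((-\infty,\sqrt n\,x))$. $w(x)$ is the semicircle distribution function, with density $p_w(x)=\frac1{2\pi}\sqrt{(4-x^2)_+}$. Lyapunov fractions: $L_{qn}=\beta_q/n^{(q-2)/2}$. *)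

theory Defs
  imports "HOL-Probability.Probability"
begin

definition cauchy_transform :: "real measure \<Rightarrow> complex \<Rightarrow> complex" where
  "cauchy_transform \<mu> z = (\<integral>u. 1 / (z - complex_of_real u) \<partial>\<mu>)"

definition recip_cauchy_transform :: "real measure \<Rightarrow> complex \<Rightarrow> complex" where
  "recip_cauchy_transform \<mu> z = 1 / cauchy_transform \<mu> z"

definition truncated_cone :: "real \<Rightarrow> real \<Rightarrow> complex set" where
  "truncated_cone \<alpha> \<beta> = {z. Im z > \<beta> \<and> \<bar>Re z\<bar> < \<alpha> * Im z}"

(* "phi is the Voiculescu transform F^(-1)(z) - z on D", F being the reciprocal Cauchy transform.
   F need not be injective on the whole upper half-plane (it is not for the symmetric Bernoulli
   law), so the inverse is that of F restricted to a truncated cone on which F is injective and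
   whose image covers D.  Since F(z)/z tends to 1 nontangentially at infinity, such cones exist,
   and for D a truncated cone the values on D do not depend on the choice. *)
definition voiculescu_transform_on ::
    "real measure \<Rightarrow> complex set \<Rightarrow> (complex \<Rightarrow> complex) \<Rightarrow> bool" where
  "voiculescu_transform_on \<mu> D \<phi> \<longleftrightarrow>
     (\<exists>\<alpha>>0. \<exists>\<beta>>0. let \<Gamma> = truncated_cone \<alpha> \<beta>; F = recip_cauchy_transform \<mu> in
        inj_on F \<Gamma> \<and> D \<subseteq> F ` \<Gamma> \<and> (\<forall>z\<in>D. \<phi> z = the_inv_into \<Gamma> F z - z))"

(* rho is the free additive convolution of mu and nu in the sense of Bercovici and Voiculescu,
   which covers arbitrary probability measures on the line, without any moment or support
   condition: Voiculescu transforms add on some truncated cone where all three are defined.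
   Such a rho exists and is unique for all probability measures mu, nu. *)
definition is_free_convolution :: "real measure \<Rightarrow> real measure \<Rightarrow> real measure \<Rightarrow> bool" where
  "is_free_convolution \<mu> \<nu> \<rho> \<longleftrightarrow> real_distribution \<rho> \<and>
     (\<exists>\<alpha>>0. \<exists>\<beta>>0. \<exists>\<phi> \<psi>.
        voiculescu_transform_on \<mu> (truncated_cone \<alpha> \<beta>) \<phi> \<and>
        voiculescu_transform_on \<nu> (truncated_cone \<alpha> \<beta>) \<psi> \<and>
        voiculescu_transform_on \<rho> (truncated_cone \<alpha> \<beta>) (\<lambda>z. \<phi> z + \<psi> z))"

(* rho is the n-fold free additive convolution of mu with itself (n >= 1), that is, the
   distribution of X_1 + ... + X_n for free X_1, ..., X_n with common distribution mu. *)
inductive is_free_convolution_power :: "real measure \<Rightarrow> nat \<Rightarrow> real measure \<Rightarrow> bool"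
  for \<mu> :: "real measure" where
  one: "is_free_convolution_power \<mu> 1 \<mu>"
| step: "is_free_convolution_power \<mu> n \<nu> \<Longrightarrow> is_free_convolution \<nu> \<mu> \<rho> \<Longrightarrow>
    is_free_convolution_power \<mu> (Suc n) \<rho>"

definition semicircle_density :: "real \<Rightarrow> real" where
  "semicircle_density u = 1 / (2 * pi) * sqrt (max 0 (4 - u\<^sup>2))"

definition semicircle_cdf :: "real \<Rightarrow> real" where
  "semicircle_cdf x = (LBINT u:{..x}. semicircle_density u)"

definition abs_moment :: "real \<Rightarrow> real measure \<Rightarrow> real" where
  "abs_moment q \<mu> = (\<integral>u. \<bar>u\<bar> powr q \<partial>\<mu>)"

definition lyapunov_fraction :: "real \<Rightarrow> real measure \<Rightarrow> nat \<Rightarrow> real" where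
  "lyapunov_fraction q \<mu> n = abs_moment q \<mu> / real n powr ((q - 2) / 2)"

end

theory Submission
  imports Defs "HOL-Complex_Analysis.Complex_Analysis"
begin

text \<open>
  Let \<open>F\<close> be the reciprocal Cauchy transform of \<open>\<mu>\<close> and \<open>A\<^sub>\<mu> z\<close> the \<open>\<mu>\<close>-mean of \<open>Arg (z - u)\<close>, so that
  \<open>A\<^sub>\<rho>\<close> has boundary values \<open>\<pi>\<close> times the upper tail of \<open>\<rho>\<close>. For \<open>\<rho> = \<mu>\<^sup>n\<close> (free power) the function
  \<open>Z = (z + (n - 1) F\<^sub>\<rho> z) / n\<close> satisfies \<open>F (Z z) = F\<^sub>\<rho> z\<close>, and integrating \<open>dz / F\<^sub>\<rho>\<close> gives the closed formula
  \<open>A\<^sub>\<rho> z = n A\<^sub>\<mu> (Z z) - (n - 1) Arg (F (Z z))\<close>. Expanding \<open>A\<^sub>\<mu>\<close> at \<open>Z z\<close>, of size \<open>sqrt n\<close>, costs \<open>O(L)\<close> even close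
  to the real line because arguments are bounded; the main term is the corresponding expression of the semicircle
  law, which is stationary in \<open>Z\<close>, so that only the square of the error in \<open>Z\<close> matters. That error is controlled
  by Brouwer's fixed point theorem around \<open>exp (i \<phi>)\<close> for \<open>x = 2 cos \<phi>\<close> with \<open>sin\<^sup>3 \<phi> \<ge> 50 L\<close>. Monotonicity of
  distribution functions covers the remaining \<open>x\<close>, where the semicircle law has mass \<open>O(L)\<close>. No smoothing inequality
  is needed, since the bounds are uniform up to the real line.
\<close>

section \<open>Reciprocal Cauchy transforms\<close>

text \<open>The power \<open>sin \<phi> ^ 3\<close> is where three requirements meet. Write s for
  sin phi. The perturbation of the semicircle equation has size L / s and its linearization at exp
  (i phi) has size s, so the root moves by about L / s^2; to stay in the upper half-plane it may
  move only by a fraction of its height s. Stationarity turns this displacement into an error s (L /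
  s^2)^2 = L (L / s^3). Finally, the semicircle mass beyond 2 cos phi is at most of order s^3.
  Cutting where s^3 is a fixed multiple of L therefore keeps the root in place, makes the quadratic
  error O(L), and discards only mass O(L). Corrections of order 1 / n, such as those from n - 1 in
  place of n, are absorbed because L is at least n^(-1/2) for q \<le> 3. A structural obstacle is
  that free convolution is given only through inverse functions on unspecified cones. The
  subordination relation is therefore obtained on a curve far up in the half-plane and continued
  analytically.\<close>

lemma diff_of_real_nonzero: "Im z > 0 \<Longrightarrow> z - complex_of_real u \<noteq> 0"
  by (auto simp: complex_eq_iff)

lemma norm_diff_of_real_ge: "Im z > 0 \<Longrightarrow> Im z \<le> cmod (z - complex_of_real u)"
  using abs_Im_le_cmod[of "z - complex_of_real u"] by simp

lemma resolvent_bound: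
  assumes "Im z > 0"
  shows "cmod (1 / (z - complex_of_real u)) \<le> 1 / Im z"
  using norm_diff_of_real_ge[OF assms, of u] assms by (auto simp: norm_divide intro!: divide_left_mono mult_pos_pos)

lemma Im_resolvent:
  assumes "Im z > 0"
  shows "Im (1 / (z - complex_of_real u)) = - Im z * (cmod (1 / (z - complex_of_real u)))\<^sup>2"
  by (simp add: norm_divide Im_divide cmod_power2 power_divide)

text \<open>Replaces differentiation under the integral sign: a quadratic remainder bound that is
  uniform in \<open>u\<close> survives integration against a probability measure.\<close>

lemma has_derivative_of_quadratic_bound:
  fixes f :: "'a::real_normed_vector \<Rightarrow> 'b::real_normed_vector"
  assumes D: "bounded_linear D" and r: "r > 0"
    and bd: "\<And>h. norm h < r \<Longrightarrow> norm (f (x + h) - f x - D h) \<le> C * (norm h)\<^sup>2"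
  shows "(f has_derivative D) (at x)"
  unfolding has_derivative_at
proof (intro conjI D)
  have "isCont (\<lambda>h::'a. C * norm h) 0" by (intro continuous_intros)
  then have lim: "((\<lambda>h::'a. C * norm h) \<longlongrightarrow> 0) (at 0)" by (simp add: isCont_def)
  have ev: "\<forall>\<^sub>F h in at (0::'a). norm (norm (f (x + h) - f x - D h) / norm h) \<le> C * norm h"
    unfolding eventually_at
  proof (intro exI[of _ r] conjI ballI impI r)
    fix h :: 'a assume h: "h \<noteq> 0 \<and> dist h 0 < r"
    then show "norm (norm (f (x + h) - f x - D h) / norm h) \<le> C * norm h"
      using bd[of h] by (simp add: divide_le_eq power2_eq_square mult.assoc)
  qed
  show "(\<lambda>h. norm (f (x + h) - f x - D h) / norm h) \<midarrow>0\<rightarrow> 0"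
    by (rule Lim_null_comparison[OF ev lim])
qed

context real_distribution
begin

lemma prob_UNIV [simp]: "prob UNIV = 1"
  using prob_space by simp

lemma borel_measurable_of_continuous:
  fixes h :: "real \<Rightarrow> 'b::{banach, second_countable_topology}"
  assumes "continuous_on UNIV h"
  shows "h \<in> borel_measurable M"
  using borel_measurable_continuous_onI[OF assms] measurable_cong_sets[OF events_eq_borel refl] by blast

lemma integrable_of_continuous_bounded:
  fixes h :: "real \<Rightarrow> 'b::{banach, second_countable_topology}"
  assumes "continuous_on UNIV h" "\<And>u. norm (h u) \<le> B"
  shows "integrable M h"
  by (rule integrable_const_bound[of _ B]) (use assms borel_measurable_of_continuous in auto)

lemma norm_integral_le_const:
  fixes h :: "real \<Rightarrow> 'b::{banach, second_countable_topology}"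
  assumes "\<And>u. norm (h u) \<le> B" "0 \<le> B"
  shows "norm (\<integral>u. h u \<partial>M) \<le> B"
proof (cases "integrable M h")
  case True
  have "norm (\<integral>u. h u \<partial>M) \<le> (\<integral>u. norm (h u) \<partial>M)" by (rule integral_norm_bound)
  also have "\<dots> \<le> (\<integral>u. B \<partial>M)" using True assms by (intro integral_mono) auto
  also have "\<dots> = B" by (simp add: prob_space)
  finally show ?thesis .
\<comment> \<open>A non-integrable function has Bochner integral 0 by convention.\<close>
qed (use assms in \<open>simp add: not_integrable_integral_eq\<close>)

lemma integrable_resolvent:
  assumes "Im z > 0"
  shows "integrable M (\<lambda>u. 1 / (z - complex_of_real u))"
  by (rule integrable_of_continuous_bounded[of _ "1 / Im z"])
     (use assms resolvent_bound diff_of_real_nonzero in \<open>auto intro!: continuous_intros\<close>)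

lemma integrable_resolvent_mult:
  assumes "Im z > 0" "Im w > 0"
  shows "integrable M (\<lambda>u. (1 / (z - complex_of_real u)) * (1 / (w - complex_of_real u)))"
proof (rule integrable_of_continuous_bounded[of _ "(1 / Im z) * (1 / Im w)"])
  fix u
  show "norm ((1 / (z - complex_of_real u)) * (1 / (w - complex_of_real u))) \<le> (1 / Im z) * (1 / Im w)"
    unfolding norm_mult by (intro mult_mono resolvent_bound assms) (use assms in auto)
qed (use assms diff_of_real_nonzero in \<open>auto intro!: continuous_intros\<close>)

lemma integrable_norm_resolvent_square:
  assumes "Im z > 0"
  shows "integrable M (\<lambda>u. (cmod (1 / (z - complex_of_real u)))\<^sup>2)"
  using integrable_norm[OF integrable_resolvent_mult[OF assms assms]]
  by (simp only: norm_mult power2_eq_square)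

lemma Im_cauchy_transform:
  assumes "Im z > 0"
  shows "Im (cauchy_transform M z) = - Im z * (\<integral>u. (cmod (1 / (z - complex_of_real u)))\<^sup>2 \<partial>M)"
proof -
  have "Im (cauchy_transform M z) = (\<integral>u. Im (1 / (z - complex_of_real u)) \<partial>M)"
    unfolding cauchy_transform_def using integrable_resolvent[OF assms] by simp
  also have "\<dots> = (\<integral>u. - Im z * (cmod (1 / (z - complex_of_real u)))\<^sup>2 \<partial>M)"
    using Im_resolvent[OF assms] by simp
  finally show ?thesis by simp
qed

lemma Im_cauchy_transform_neg:
  assumes "Im z > 0"
  shows "Im (cauchy_transform M z) < 0"
proof -
  let ?h = "\<lambda>u. (cmod (1 / (z - complex_of_real u)))\<^sup>2"
  have "(\<integral>u. ?h u \<partial>M) \<noteq> 0"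
  proof
    assume "(\<integral>u. ?h u \<partial>M) = 0"
    then have "AE u in M. ?h u = 0"
      using integral_nonneg_eq_0_iff_AE[OF integrable_norm_resolvent_square[OF assms]] by simp
    moreover have "?h u \<noteq> 0" for u using diff_of_real_nonzero[OF assms] by simp
    ultimately have "AE u in M. False" by simp
    then show False by simp
  qed
  moreover have "(\<integral>u. ?h u \<partial>M) \<ge> 0" by simp
  ultimately have "(\<integral>u. ?h u \<partial>M) > 0" by (metis less_eq_real_def)
  then show ?thesis unfolding Im_cauchy_transform[OF assms] using assms by simp
qed

lemma cauchy_transform_nonzero: "Im z > 0 \<Longrightarrow> cauchy_transform M z \<noteq> 0"
  using Im_cauchy_transform_neg by fastforce

lemma cauchy_transform_recip: "1 / recip_cauchy_transform M z = cauchy_transform M z"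
  by (simp add: recip_cauchy_transform_def)

lemma recip_cauchy_transform_nonzero: "Im z > 0 \<Longrightarrow> recip_cauchy_transform M z \<noteq> 0"
  using cauchy_transform_nonzero by (simp add: recip_cauchy_transform_def)

lemma has_field_derivative_cauchy_transform:
  assumes z: "Im z > 0"
  shows "(cauchy_transform M has_field_derivative - (\<integral>u. (1 / (z - complex_of_real u)) * (1 / (z - complex_of_real u)) \<partial>M)) (at z)"
  unfolding has_field_derivative_def
proof (rule has_derivative_of_quadratic_bound[where r = "Im z / 2" and C = "2 / (Im z)^3"])
  define f where "f = (\<lambda>z u. 1 / (z - complex_of_real u))"
  fix h :: complex assume h: "norm h < Im z / 2"
  have zh: "Im (z + h) \<ge> Im z / 2" using h abs_Im_le_cmod[of h] by auto
  then have zh0: "Im (z + h) > 0" using z by linarith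
  \<comment> \<open>Exact remainder from applying the resolvent identity twice. Since
    \<open>z + h\<close> keeps at least half the height of \<open>z\<close>, the three resolvent
    factors produce the constant \<open>2 / (Im z)^3\<close>.\<close>
  have eq: "f (z + h) u - f z u + f z u * f z u * h = h^2 * (f z u * f z u) * f (z + h) u" for u
    using diff_of_real_nonzero[OF z, of u] diff_of_real_nonzero[OF zh0, of u]
    by (simp add: f_def divide_simps power2_eq_square) (simp add: algebra_simps)
  have "cauchy_transform M (z + h) - cauchy_transform M z - - (\<integral>u. f z u * f z u \<partial>M) * h
      = (\<integral>u. f (z + h) u - f z u + f z u * f z u * h \<partial>M)"
    using integrable_resolvent[OF z] integrable_resolvent[OF zh0] integrable_resolvent_mult[OF z z]
    unfolding cauchy_transform_def f_def[symmetric, THEN fun_cong, THEN fun_cong] by simp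
  also have "\<dots> = (\<integral>u. h^2 * (f z u * f z u) * f (z + h) u \<partial>M)" by (simp only: eq)
  finally have 1: "cauchy_transform M (z + h) - cauchy_transform M z - - (\<integral>u. f z u * f z u \<partial>M) * h
      = (\<integral>u. h^2 * (f z u * f z u) * f (z + h) u \<partial>M)" .
  have "norm (h^2 * (f z u * f z u) * f (z + h) u) \<le> (norm h)^2 * ((1 / Im z) * (1 / Im z)) * (1 / (Im z / 2))" for u
  proof -
    have "norm (f (z + h) u) \<le> 1 / (Im z / 2)"
      using resolvent_bound[OF zh0, of u] zh z unfolding f_def by (smt (verit) frac_le half_gt_zero)
    moreover have "norm (f z u) \<le> 1 / Im z" unfolding f_def by (rule resolvent_bound[OF z])
    ultimately show ?thesis unfolding norm_mult norm_power
      by (intro mult_mono order_refl) (use z in auto)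
  qed
  then have "norm (\<integral>u. h^2 * (f z u * f z u) * f (z + h) u \<partial>M) \<le> (norm h)^2 * ((1 / Im z) * (1 / Im z)) * (1 / (Im z / 2))"
    by (rule norm_integral_le_const) (use z in auto)
  also have "\<dots> = 2 / (Im z)^3 * (norm h)\<^sup>2" using z by (simp add: power3_eq_cube)
  finally show "norm (cauchy_transform M (z + h) - cauchy_transform M z - - (\<integral>u. (1 / (z - complex_of_real u)) * (1 / (z - complex_of_real u)) \<partial>M) * h) \<le> 2 / (Im z)^3 * (norm h)\<^sup>2"
    using 1 unfolding f_def by simp
qed (use z in \<open>auto intro: bounded_linear_mult_right\<close>)

lemma holomorphic_recip_cauchy_transform: "recip_cauchy_transform M holomorphic_on {z. Im z > 0}"
proof -
  have "cauchy_transform M holomorphic_on {z. Im z > 0}"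
    using has_field_derivative_cauchy_transform by (auto simp: holomorphic_on_open open_halfspace_Im_gt)
  then show ?thesis
    unfolding recip_cauchy_transform_def[abs_def]
    by (intro holomorphic_intros) (auto dest: cauchy_transform_nonzero)
qed

text \<open>The function \<open>g = (1 / (z - u)) / G - 1\<close> has mean zero and squared norm \<open>Im (F z) / Im z - 1\<close>;
  this replaces the Nevanlinna representation of \<open>F\<close>.\<close>

lemma normalized_resolvent_variance:
  assumes z: "Im z > 0"
  defines "F \<equiv> recip_cauchy_transform M z"
  shows "integrable M (\<lambda>u. (cmod (F / (z - complex_of_real u) - 1))\<^sup>2)"
    and "(\<integral>u. (cmod (F / (z - complex_of_real u) - 1))\<^sup>2 \<partial>M) = Im F / Im z - 1"
proof -
  let ?f = "\<lambda>u. 1 / (z - complex_of_real u)"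
  let ?G = "cauchy_transform M z"
  have "(cmod (y - 1))\<^sup>2 = (cmod y)\<^sup>2 - 2 * Re y + 1" for y
    unfolding cmod_power2 by (simp add: power2_eq_square algebra_simps)
  from this[of "F * ?f _"]
  have eq: "(cmod (F / (z - complex_of_real u) - 1))\<^sup>2 = (cmod F)^2 * (cmod (?f u))^2 - 2 * Re (F * ?f u) + 1" for u
    by (simp add: norm_divide power_divide)
  have i1: "integrable M (\<lambda>u. (cmod F)^2 * (cmod (?f u))^2)"
    using integrable_norm_resolvent_square[OF z] by simp
  have i2: "integrable M (\<lambda>u. F * ?f u)" using integrable_resolvent[OF z] by (rule integrable_mult_right)
  then have i2': "integrable M (\<lambda>u. 2 * Re (F * ?f u))" by (intro integrable_mult_right) auto
  show "integrable M (\<lambda>u. (cmod (F / (z - complex_of_real u) - 1))\<^sup>2)"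
    unfolding eq using i1 i2' by auto
  have "(\<integral>u. 2 * Re (F * ?f u) \<partial>M) = 2 * Re (\<integral>u. F * ?f u \<partial>M)"
    using i2 by simp
  also have "(\<integral>u. F * ?f u \<partial>M) = F * ?G"
    unfolding cauchy_transform_def by (rule integral_mult_right_zero)
  also have "F * ?G = 1" unfolding F_def recip_cauchy_transform_def using cauchy_transform_nonzero[OF z] by simp
  finally have e2: "(\<integral>u. 2 * Re (F * ?f u) \<partial>M) = 2" by simp
  have "(\<integral>u. (cmod (?f u))^2 \<partial>M) = - Im ?G / Im z"
    using Im_cauchy_transform[OF z] z by (simp add: field_simps)
  also have "Im ?G = - Im F / (cmod F)^2"
    using cauchy_transform_nonzero[OF z]
    by (simp add: F_def flip: cauchy_transform_recip) (simp add: Im_divide cmod_power2)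
  finally have e1: "(cmod F)^2 * (\<integral>u. (cmod (?f u))^2 \<partial>M) = Im F / Im z"
    using recip_cauchy_transform_nonzero[OF z] by (simp add: F_def)
  show "(\<integral>u. (cmod (F / (z - complex_of_real u) - 1))\<^sup>2 \<partial>M) = Im F / Im z - 1"
    unfolding eq using i1 i2' e1 e2 by (simp add: prob_space)
qed

text \<open>The excess \<open>Im F / Im z - 1\<close> is a variance, hence nonnegative.\<close>

lemma Im_recip_cauchy_transform_ge:
  assumes "Im z > 0"
  shows "Im z \<le> Im (recip_cauchy_transform M z)"
proof -
  have "0 \<le> Im (recip_cauchy_transform M z) / Im z - 1"
    unfolding normalized_resolvent_variance(2)[OF assms, symmetric] by simp
  then show ?thesis using assms by (simp add: field_simps)
qed

text \<open>Up to sign, the difference quotient of z - F z is the bilinear covariance of the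
  normalized resolvents at \<open>z\<close> and \<open>w\<close>; bounding the product by half the
  sum of squares leaves the mean of the two variances. This Lipschitz estimate is the source of
  injectivity for the subordination equation.\<close>

lemma recip_cauchy_transform_defect_diff:
  assumes z: "Im z > 0" and w: "Im w > 0"
  defines "F \<equiv> recip_cauchy_transform M"
  shows "cmod ((z - F z) - (w - F w))
    \<le> cmod (z - w) * ((Im (F z) / Im z - 1) + (Im (F w) / Im w - 1)) / 2"
proof -
  let ?f = "\<lambda>z u. 1 / (z - complex_of_real u)"
  let ?g = "\<lambda>z u. F z / (z - complex_of_real u) - 1"
  note iz = integrable_resolvent[OF z] and iw = integrable_resolvent[OF w]
    and izw = integrable_resolvent_mult[OF z w]
  have mean: "(\<integral>u. F v * ?f v u \<partial>M) = 1" if "Im v > 0" for v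
  proof -
    have "(\<integral>u. F v * ?f v u \<partial>M) = F v * (\<integral>u. ?f v u \<partial>M)"
      by (rule integral_mult_right_zero)
    then show ?thesis
      using cauchy_transform_nonzero[OF that] unfolding F_def recip_cauchy_transform_def
      by (simp add: cauchy_transform_def)
  qed
  have "(z - w) * (?f z u * ?f w u) = ?f w u - ?f z u" for u
    using diff_of_real_nonzero[OF z, of u] diff_of_real_nonzero[OF w, of u] by (simp add: field_simps)
  then have "(z - w) * (\<integral>u. ?f z u * ?f w u \<partial>M) = (\<integral>u. ?f w u - ?f z u \<partial>M)"
    by (simp flip: integral_mult_right_zero)
  also have "\<dots> = 1 / F w - 1 / F z"
    using iz iw by (simp add: F_def cauchy_transform_recip) (simp add: cauchy_transform_def)
  finally have "(z - w) * (F z * F w * (\<integral>u. ?f z u * ?f w u \<partial>M)) = F z - F w"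
    using recip_cauchy_transform_nonzero[OF z] recip_cauchy_transform_nonzero[OF w]
    by (simp add: F_def field_simps)
  moreover have "(\<integral>u. ?g z u * ?g w u \<partial>M) = F z * F w * (\<integral>u. ?f z u * ?f w u \<partial>M) - 1"
  proof -
    have "(\<integral>u. ?g z u * ?g w u \<partial>M) = (\<integral>u. (F z * F w) * (?f z u * ?f w u) - F z * ?f z u - F w * ?f w u + 1 \<partial>M)"
      by (intro Bochner_Integration.integral_cong refl) (simp add: algebra_simps)
    also have "\<dots> = (\<integral>u. (F z * F w) * (?f z u * ?f w u) \<partial>M) - (\<integral>u. F z * ?f z u \<partial>M) - (\<integral>u. F w * ?f w u \<partial>M) + 1"
      using integrable_mult_right[OF izw, of "F z * F w"] integrable_mult_right[OF iz, of "F z"] integrable_mult_right[OF iw, of "F w"]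
      by (simp add: prob_space del: integral_mult_right_zero integrable_mult_right)
    also have "\<dots> = F z * F w * (\<integral>u. ?f z u * ?f w u \<partial>M) - 1"
      unfolding mean[OF z] mean[OF w] by (subst integral_mult_right_zero) simp
    finally show ?thesis .
  qed
  moreover have "(z - a) - (w - b) = - (z - w) * J" if "(z - w) * p = a - b" "J = p - 1" for a b p J
    using that(1) unfolding that(2) by (simp add: algebra_simps)
  ultimately have eq: "(z - F z) - (w - F w) = - (z - w) * (\<integral>u. ?g z u * ?g w u \<partial>M)"
    by blast
  have "cmod (\<integral>u. ?g z u * ?g w u \<partial>M) \<le> (\<integral>u. cmod (?g z u * ?g w u) \<partial>M)" by (rule integral_norm_bound)
  also have "\<dots> \<le> (\<integral>u. ((cmod (?g z u))^2 + (cmod (?g w u))^2) / 2 \<partial>M)"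
  proof (rule integral_mono_AE')
    show "integrable M (\<lambda>u. ((cmod (?g z u))^2 + (cmod (?g w u))^2) / 2)"
      using normalized_resolvent_variance(1)[OF z] normalized_resolvent_variance(1)[OF w] by (simp add: F_def)
    have "cmod (?g z u * ?g w u) \<le> ((cmod (?g z u))^2 + (cmod (?g w u))^2) / 2" for u
      using sum_squares_bound[of "cmod (?g z u)" "cmod (?g w u)"] by (simp add: norm_mult)
    then show "AE u in M. cmod (?g z u * ?g w u) \<le> ((cmod (?g z u))^2 + (cmod (?g w u))^2) / 2"
      by simp
  qed simp
  also have "\<dots> = ((Im (F z) / Im z - 1) + (Im (F w) / Im w - 1)) / 2"
    using normalized_resolvent_variance[OF z] normalized_resolvent_variance[OF w] by (simp add: F_def)
  finally show ?thesis unfolding eq norm_mult norm_minus_cancel times_divide_eq_right[symmetric]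
    by (intro mult_left_mono) auto
qed

end

section \<open>The defect z - F z under mean zero and variance one\<close>

locale standardized_distribution = real_distribution +
  assumes integrable_square: "integrable M (\<lambda>u. u\<^sup>2)"
    and mean_zero: "(\<integral>u. u \<partial>M) = 0"
    and variance_one: "(\<integral>u. u\<^sup>2 \<partial>M) = 1"
begin

lemma integrable_id: "integrable M (\<lambda>u. u)"
proof (rule Bochner_Integration.integrable_bound)
  show "integrable M (\<lambda>u. 1 + u\<^sup>2)" using integrable_square by simp
  have "\<bar>u\<bar> \<le> 1 + u\<^sup>2" for u :: real
    using sum_squares_bound[of 1 "\<bar>u\<bar>"] by simp
  then show "AE u in M. norm u \<le> norm (1 + u\<^sup>2)" by auto
qed (auto intro: borel_measurable_of_continuous continuous_intros)

text \<open>Because the mean is zero, z - F z is the covariance of \<open>u\<close> with the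
  normalized resolvent. The arithmetic-geometric mean inequality with weights
  \<open>1 / Im z\<close> and \<open>Im z\<close> bounds it by the two variances, and the second
  variance is again an expression in z - F z.\<close>

lemma norm_defect_le:
  assumes z: "Im z > 0"
  shows "cmod (z - recip_cauchy_transform M z) \<le> 1 / Im z"
proof -
  define F where "F = recip_cauchy_transform M z"
  let ?f = "\<lambda>u. 1 / (z - complex_of_real u)"
  let ?g = "\<lambda>u. F / (z - complex_of_real u) - 1"
  have FG: "F * (\<integral>u. ?f u \<partial>M) = 1"
    using cauchy_transform_nonzero[OF z] unfolding F_def recip_cauchy_transform_def by (simp add: cauchy_transform_def)
  have iu: "integrable M (\<lambda>u. complex_of_real u)" using integrable_id by (simp add: integrable_of_real)
  have "complex_of_real u * ?g u = F * (z * ?f u) - F - u" for u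
    using diff_of_real_nonzero[OF z, of u] by (simp add: field_simps)
  then have "(\<integral>u. complex_of_real u * ?g u \<partial>M) = (\<integral>u. F * (z * ?f u) - F - u \<partial>M)" by (simp only:)
  also have "\<dots> = F * (z * (\<integral>u. ?f u \<partial>M)) - F - (\<integral>u. complex_of_real u \<partial>M)"
    using integrable_mult_right[OF integrable_mult_right[OF integrable_resolvent[OF z], of z], of F] iu integrable_resolvent[OF z]
    by (simp add: prob_space del: times_divide_eq_right)
  also have "F * (z * (\<integral>u. ?f u \<partial>M)) = z * (F * (\<integral>u. ?f u \<partial>M))" by (simp only: mult_ac)
  also have "(\<integral>u. complex_of_real u \<partial>M) = 0"
    by (simp add: mean_zero)
  finally have eq: "z - F = (\<integral>u. complex_of_real u * ?g u \<partial>M)" by (simp only: FG) simp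
  let ?a = "1 / Im z"
  have a: "?a > 0" using z by simp
  have "cmod (z - F) \<le> (\<integral>u. cmod (complex_of_real u * ?g u) \<partial>M)" unfolding eq by (rule integral_norm_bound)
  also have "\<dots> \<le> (\<integral>u. (?a * u^2 + Im z * (cmod (?g u))^2) / 2 \<partial>M)"
  proof (rule integral_mono_AE')
    show "integrable M (\<lambda>u. (?a * u^2 + Im z * (cmod (?g u))^2) / 2)"
      using normalized_resolvent_variance(1)[OF z] integrable_square by (simp add: F_def)
    have "cmod (complex_of_real u * ?g u) \<le> (?a * u^2 + Im z * (cmod (?g u))^2) / 2" for u
    proof -
      have "0 \<le> Im z * (?a * \<bar>u\<bar> - cmod (?g u))^2" using z by simp
      also have "\<dots> = ?a * u^2 + Im z * (cmod (?g u))^2 - 2 * (\<bar>u\<bar> * cmod (?g u))"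
        using z by (simp add: power2_eq_square field_simps)
      finally show ?thesis by (simp add: norm_mult)
    qed
    then show "AE u in M. cmod (complex_of_real u * ?g u) \<le> (?a * u^2 + Im z * (cmod (?g u))^2) / 2" by simp
  qed (use z in simp)
  also have "\<dots> = (?a + Im z * (Im F / Im z - 1)) / 2"
    using normalized_resolvent_variance[OF z] integrable_square by (simp add: F_def variance_one)
  \<comment> \<open>The bound now contains half of the quantity to be estimated, which is absorbed
    on the left.\<close>
  also have "\<dots> = (?a - Im (z - F)) / 2" using z by (simp add: field_simps)
  also have "\<dots> \<le> (?a + cmod (z - F)) / 2" using abs_Im_le_cmod[of "z - F"] by simp
  finally show ?thesis unfolding F_def by simp
qed

end

section \<open>Subordination for free convolution powers\<close>

text \<open>As t is at least 1, the disc of radius c / t lies in the one of radius c. The summand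
  \<beta> then pays for the height and c / \<alpha> for the slope of the cone.\<close>

lemma mem_truncated_cone:
  assumes "\<alpha> > 0" "\<beta> > 0" "c \<ge> 0" "t \<ge> 1 + c + \<beta> + c / \<alpha>" "cmod (w - \<i> * of_real t) \<le> c / t"
  shows "w \<in> truncated_cone \<alpha> \<beta>"
proof -
  have ca: "c / \<alpha> \<ge> 0" using assms by simp
  have t: "t \<ge> 1" using assms ca by linarith
  then have "c / t \<le> c" using assms(3) by (simp add: divide_le_eq mult_le_cancel_left1)
  then have d: "cmod (w - \<i> * of_real t) \<le> c" using assms by linarith
  have "\<bar>Im w - t\<bar> \<le> c" using abs_Im_le_cmod[of "w - \<i> * of_real t"] d by simp
  then have im: "Im w \<ge> 1 + \<beta> + c / \<alpha>" using assms(4) by linarith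
  have "\<bar>Re w\<bar> \<le> c" using abs_Re_le_cmod[of "w - \<i> * of_real t"] d by simp
  also have "c = \<alpha> * (c / \<alpha>)" using assms by simp
  finally have "\<bar>Re w\<bar> \<le> \<alpha> * (c / \<alpha>)" .
  also have "\<dots> < \<alpha> * Im w" using im assms by (intro mult_strict_left_mono) auto
  finally have "\<bar>Re w\<bar> < \<alpha> * Im w" .
  moreover have "\<beta> < Im w" using im ca by linarith
  ultimately show ?thesis unfolding truncated_cone_def by simp
qed

text \<open>Splits the inverse function into its two one-sided laws, so that
  \<open>the_inv_into\<close> and the injectivity cone disappear from all later arguments.\<close>

lemma voiculescu_transform_onD:
  assumes "voiculescu_transform_on \<mu> D \<phi>"
  obtains \<alpha> \<beta> where "\<alpha> > 0" "\<beta> > 0"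
    "\<And>w. w \<in> truncated_cone \<alpha> \<beta> \<Longrightarrow> recip_cauchy_transform \<mu> w \<in> D \<Longrightarrow>
        \<phi> (recip_cauchy_transform \<mu> w) = w - recip_cauchy_transform \<mu> w"
    "\<And>z. z \<in> D \<Longrightarrow> recip_cauchy_transform \<mu> (z + \<phi> z) = z"
proof -
  let ?F = "recip_cauchy_transform \<mu>"
  obtain \<alpha> \<beta> where *: "\<alpha> > 0" "\<beta> > 0" "inj_on ?F (truncated_cone \<alpha> \<beta>)"
     "D \<subseteq> ?F ` truncated_cone \<alpha> \<beta>" "\<And>z. z \<in> D \<Longrightarrow> \<phi> z = the_inv_into (truncated_cone \<alpha> \<beta>) ?F z - z"
    using assms unfolding voiculescu_transform_on_def Let_def by blast
  show thesis
  proof (rule that[OF *(1,2)])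
    fix w assume "w \<in> truncated_cone \<alpha> \<beta>" "?F w \<in> D"
    then show "\<phi> (?F w) = w - ?F w" using the_inv_into_f_f[OF *(3)] *(5) by simp
  next
    fix z assume "z \<in> D"
    then show "?F (z + \<phi> z) = z" using f_the_inv_into_f[OF *(3), of z] *(4,5) by auto
  qed
qed

text \<open>Subordination in inverse form: it avoids having to compare the inverses of \<open>F\<close> on different cones.\<close>

lemma (in standardized_distribution) free_convolution_power_imag_axis:
  assumes "is_free_convolution_power M n N"
  defines "F \<equiv> recip_cauchy_transform M"
  shows "n \<ge> 1 \<and> real_distribution N \<and>
    (\<exists>T>0. \<forall>t\<ge>T. recip_cauchy_transform N (of_nat n * (\<i> * of_real t) - (of_nat n - 1) * F (\<i> * of_real t))
       = F (\<i> * of_real t))"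
  using assms(1)
proof (induction rule: is_free_convolution_power.induct)
  case one
  then show ?case using real_distribution_axioms by (auto simp: F_def intro: exI[of _ 1])
next
  case (step n \<nu> \<rho>)
  obtain T where T: "T > 0" "\<And>t. t \<ge> T \<Longrightarrow> recip_cauchy_transform \<nu>
      (of_nat n * (\<i> * of_real t) - (of_nat n - 1) * F (\<i> * of_real t)) = F (\<i> * of_real t)"
    and n1: "n \<ge> 1" using step.IH by blast
  obtain \<alpha> \<beta> \<phi> \<psi> where ab: "\<alpha> > 0" "\<beta> > 0"
    and v1: "voiculescu_transform_on \<nu> (truncated_cone \<alpha> \<beta>) \<phi>"
    and v2: "voiculescu_transform_on M (truncated_cone \<alpha> \<beta>) \<psi>"
    and v3: "voiculescu_transform_on \<rho> (truncated_cone \<alpha> \<beta>) (\<lambda>z. \<phi> z + \<psi> z)"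
    and \<rho>: "real_distribution \<rho>"
    using step.hyps(2) unfolding is_free_convolution_def by blast
  obtain a1 b1 where 1: "a1 > 0" "b1 > 0"
    "\<And>w. w \<in> truncated_cone a1 b1 \<Longrightarrow> recip_cauchy_transform \<nu> w \<in> truncated_cone \<alpha> \<beta> \<Longrightarrow>
        \<phi> (recip_cauchy_transform \<nu> w) = w - recip_cauchy_transform \<nu> w"
    by (rule voiculescu_transform_onD[OF v1]) auto
  obtain a2 b2 where 2: "a2 > 0" "b2 > 0"
    "\<And>w. w \<in> truncated_cone a2 b2 \<Longrightarrow> F w \<in> truncated_cone \<alpha> \<beta> \<Longrightarrow> \<psi> (F w) = w - F w"
    unfolding F_def by (rule voiculescu_transform_onD[OF v2]) auto
  have 3: "recip_cauchy_transform \<rho> (z + (\<phi> z + \<psi> z)) = z" if "z \<in> truncated_cone \<alpha> \<beta>" for z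
    by (rule voiculescu_transform_onD[OF v3]) (use that in blast)
  \<comment> \<open>The summands put three points into their cones by
    \<open>mem_truncated_cone\<close>: F z into the common cone (c = 1), the point \<open>w\<close>
    into that of \<nu> (c = n), and \<open>z\<close> itself into that of \<open>M\<close> (c =
    0).\<close>
  let ?T = "T + (1 + 1 + \<beta> + 1 / \<alpha>) + (1 + real n + b1 + real n / a1) + (1 + b2)"
  have T_pos: "?T > 0" using T ab 1 2 by (intro add_pos_nonneg) auto
  have "recip_cauchy_transform \<rho> (of_nat (Suc n) * (\<i> * of_real t) - (of_nat (Suc n) - 1) * F (\<i> * of_real t)) = F (\<i> * of_real t)"
    if t: "t \<ge> ?T" for t
  proof -
    define z where "z = \<i> * complex_of_real t"
    have nn: "1 / \<alpha> \<ge> 0" "real n / a1 \<ge> 0" using ab 1 by auto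
    have t': "t \<ge> T" "t \<ge> 1 + 1 + \<beta> + 1 / \<alpha>" "t \<ge> 1 + real n + b1 + real n / a1" "t \<ge> 1 + 0 + b2 + 0 / a2"
      using t T(1) ab 1(1,2) 2(1,2) nn by (simp_all only: div_0 add_0_right)
    then have t0: "t > 0" using T by linarith
    have E: "cmod (z - F z) \<le> 1 / t" using norm_defect_le[of z] t0 unfolding F_def by (simp add: z_def)
    have p: "F z \<in> truncated_cone \<alpha> \<beta>"
      by (rule mem_truncated_cone[OF ab _ t'(2)]) (use E in \<open>auto simp: z_def norm_minus_commute\<close>)
    have z: "z \<in> truncated_cone a2 b2"
      by (rule mem_truncated_cone[OF 2(1,2) _ t'(4)]) (auto simp: z_def)
    define w where "w = of_nat n * z - (of_nat n - 1) * F z"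
    have "w - z = of_real (real n - 1) * (z - F z)" by (simp add: w_def algebra_simps)
    then have "cmod (w - z) = (real n - 1) * cmod (z - F z)"
      using n1 by (simp only: norm_mult norm_of_real)
    also have "\<dots> \<le> real n * (1 / t)" using n1 E by (intro mult_mono) auto
    finally have wz: "cmod (w - z) \<le> real n / t" by simp
    have w: "w \<in> truncated_cone a1 b1"
      by (rule mem_truncated_cone[OF 1(1,2) _ t'(3)]) (use wz in \<open>auto simp: z_def\<close>)
    have Fw: "recip_cauchy_transform \<nu> w = F z" using T(2)[OF t'(1)] by (simp add: w_def z_def)
    have "\<phi> (F z) = w - F z" using 1(3)[OF w] Fw p by simp
    moreover have "\<psi> (F z) = z - F z" using 2(3)[OF z p] .
    ultimately have "F z + (\<phi> (F z) + \<psi> (F z)) = of_nat (Suc n) * z - (of_nat (Suc n) - 1) * F z"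
      unfolding w_def by (simp only:) (simp add: algebra_simps)
    then show ?thesis using 3[OF p] by (simp add: z_def)
  qed
  then show ?case using T_pos \<rho> by auto
qed

section \<open>Subordination on the whole upper half-plane\<close>

locale free_power = standardized_distribution M for M +
  fixes N :: "real measure" and n :: nat
  assumes free_power: "is_free_convolution_power M n N"
begin

abbreviation "F \<equiv> recip_cauchy_transform M"

lemma n_ge_1: "n \<ge> 1" and real_distribution_N: "real_distribution N"
  using free_convolution_power_imag_axis[OF free_power] by auto

sublocale N: real_distribution N by (rule real_distribution_N)

definition subord :: "complex \<Rightarrow> complex" where
  "subord z = (z + (of_nat n - 1) * recip_cauchy_transform N z) / of_nat n"

lemma of_nat_diff_one: "(of_nat n - 1 :: complex) = of_real (real n - 1)" by simp

lemma Im_subord_ge: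
  assumes "Im z > 0"
  shows "Im z \<le> Im (subord z)"
proof -
  have eq: "Im (subord z) = (Im z + (real n - 1) * Im (recip_cauchy_transform N z)) / real n"
    unfolding subord_def of_nat_diff_one by (simp add: Im_divide_of_nat)
  have "Im z + (real n - 1) * Im (recip_cauchy_transform N z) \<ge> Im z + (real n - 1) * Im z"
    using n_ge_1 N.Im_recip_cauchy_transform_ge[OF assms] by (intro add_left_mono mult_left_mono) auto
  then show ?thesis unfolding eq using n_ge_1 by (simp add: le_divide_eq algebra_simps)
qed

lemma holomorphic_subord: "subord holomorphic_on {z. Im z > 0}"
  unfolding subord_def[abs_def] using N.holomorphic_recip_cauchy_transform n_ge_1
  by (intro holomorphic_intros) auto

text \<open>Positive imaginary part of the common value says exactly that (n - 1) (Im F / Im - 1) <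
  1 at both points. By the Lipschitz estimate for the defect, (n - 1) times the defect is then
  strictly contracting between them.\<close>

lemma subordination_inj:
  assumes z: "Im z > 0" and w: "Im w > 0"
    and eq: "of_nat n * z - (of_nat n - 1) * F z = of_nat n * w - (of_nat n - 1) * F w"
    and pos: "Im (of_nat n * w - (of_nat n - 1) * F w) > 0"
  shows "z = w"
proof (rule ccontr)
  assume "z \<noteq> w"
  let ?c = "real n - 1"
  have c: "?c \<ge> 0" using n_ge_1 by simp
  have im: "Im (of_nat n * v - (of_nat n - 1) * F v) = Im v - ?c * (Im (F v) - Im v)" for v
    unfolding of_nat_diff_one by (simp add: algebra_simps)
  have "z - w = - of_real ?c * ((z - F z) - (w - F w))"
    using eq by (simp add: algebra_simps)
  then have "cmod (z - w) = ?c * cmod ((z - F z) - (w - F w))"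
    by (simp only: norm_mult norm_minus_cancel norm_of_real) (use c in simp)
  also have "\<dots> \<le> ?c * (cmod (z - w) * ((Im (F z) / Im z - 1) + (Im (F w) / Im w - 1)) / 2)"
    by (intro mult_left_mono recip_cauchy_transform_defect_diff z w c)
  also have "\<dots> = cmod (z - w) * ((?c * (Im (F z) / Im z - 1) + ?c * (Im (F w) / Im w - 1)) / 2)"
    by (simp add: algebra_simps)
  also have "\<dots> < cmod (z - w) * 1"
  proof (rule mult_strict_left_mono)
    have "?c * (Im (F w) - Im w) < Im w" using pos im[of w] by simp
    then have 1: "?c * (Im (F w) / Im w - 1) < 1" using w by (simp add: field_simps)
    have "?c * (Im (F z) - Im z) < Im z" using pos im[of z] unfolding eq[symmetric] by simp
    then have 2: "?c * (Im (F z) / Im z - 1) < 1" using z by (simp add: field_simps)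
    show "(?c * (Im (F z) / Im z - 1) + ?c * (Im (F w) / Im w - 1)) / 2 < 1"
      using add_strict_mono[OF 2 1] by (simp only: less_divide_eq_1 divide_less_eq_1) simp
  qed (use \<open>z \<noteq> w\<close> in simp)
  finally show False by simp
qed

text \<open>On the curve \<open>H\<close> the relation is the inverse form already known, since
  \<open>subord\<close> sends \<open>H t\<close> back to \<open>\<i> * of_real t\<close>. Continuity
  and injectivity of \<open>H\<close> make \<open>H S\<close> an accumulation point of the curve,
  and the identity theorem does the rest.\<close>

lemma F_subord:
  assumes "Im z > 0"
  shows "F (subord z) = recip_cauchy_transform N z"
proof -
  define H where "H = (\<lambda>t::real. of_nat n * (\<i> * of_real t) - (of_nat n - 1) * F (\<i> * of_real t))"
  obtain T where T: "T > 0" "\<And>t. t \<ge> T \<Longrightarrow> recip_cauchy_transform N (H t) = F (\<i> * of_real t)"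
    using free_convolution_power_imag_axis[OF free_power] unfolding H_def by blast
  \<comment> \<open>For t \<ge> n the defect bound 1 / t \<le> 1 costs at most n - 1 in Im (H t), so
    the curve stays in the upper half-plane.\<close>
  define S where "S = T + real n"
  have S: "S > 0" "S \<ge> T" "S \<ge> real n" "S \<ge> 1" using T n_ge_1 by (auto simp: S_def)
  have ImH: "Im (H t) > 0" if "t \<ge> S" for t
  proof -
    have t: "t > 0" "t \<ge> 1" "t \<ge> real n" using that S by auto
    have "Im (H t) = t + (real n - 1) * Im (\<i> * of_real t - F (\<i> * of_real t))"
      unfolding H_def of_nat_diff_one by (simp add: algebra_simps)
    moreover have "\<bar>Im (\<i> * of_real t - F (\<i> * of_real t))\<bar> \<le> 1 / t"
      using norm_defect_le[of "\<i> * of_real t"] abs_Im_le_cmod[of "\<i> * of_real t - F (\<i> * of_real t)"] t by simp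
    then have "Im (\<i> * of_real t - F (\<i> * of_real t)) \<ge> - 1"
      using t by (smt (verit) le_divide_eq_1 divide_le_eq_1)
    then have "(real n - 1) * Im (\<i> * of_real t - F (\<i> * of_real t)) \<ge> (real n - 1) * (-1)"
      using n_ge_1 by (intro mult_left_mono) auto
    moreover have "(real n - 1) * (-1) = 1 - real n" by simp
    ultimately show ?thesis using t(3) by (smt (verit))
  qed
  have injH: "H s \<noteq> H t" if "t \<ge> S" "s \<ge> S" "s \<noteq> t" for s t
    using subordination_inj[of "\<i> * of_real s" "\<i> * of_real t"] ImH[of t] that S unfolding H_def by auto
  have contH: "isCont H t" if "t \<ge> S" for t
  proof -
    have "continuous_on {z. Im z > 0} F"
      by (rule holomorphic_on_imp_continuous_on[OF holomorphic_recip_cauchy_transform])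
    then have "isCont F (\<i> * of_real t)"
      using that S by (simp add: continuous_on_eq_continuous_at open_halfspace_Im_gt)
    then have "isCont (\<lambda>t. F (\<i> * of_real t)) t" by (rule isCont_o2[rotated]) simp
    then show ?thesis unfolding H_def by simp
  qed
  have lim: "H S islimpt H ` {S..}"
    unfolding islimpt_approachable
  proof (intro allI impI)
    fix e :: real assume "e > 0"
    then obtain d where d: "d > 0" "\<And>t. dist t S < d \<Longrightarrow> dist (H t) (H S) < e"
      using contH[of S] unfolding continuous_at_eps_delta by (metis order_refl dist_commute)
    have "dist (H (S + d / 2)) (H S) < e" using d by (intro d(2)) (auto simp: dist_real_def)
    moreover have "H (S + d / 2) \<noteq> H S" using d by (intro injH) auto
    ultimately show "\<exists>x'\<in>H ` {S..}. x' \<noteq> H S \<and> dist x' (H S) < e"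
      using d by (intro bexI[of _ "H (S + d / 2)"]) auto
  qed
  have sub: "subord ` {z. Im z > 0} \<subseteq> {z. Im z > 0}" using Im_subord_ge by fastforce
  have "F (subord z) - recip_cauchy_transform N z = 0"
  proof (rule analytic_continuation[where S = "{z. Im z > 0}" and U = "H ` {S..}" and \<xi> = "H S"
        and f = "\<lambda>z. F (subord z) - recip_cauchy_transform N z"])
    show "(\<lambda>z. F (subord z) - recip_cauchy_transform N z) holomorphic_on {z. Im z > 0}"
      using holomorphic_on_compose_gen[OF holomorphic_subord holomorphic_recip_cauchy_transform sub]
        N.holomorphic_recip_cauchy_transform
      by (intro holomorphic_on_diff) (auto simp: o_def)
    show "connected {z. Im z > 0}" by (intro convex_connected convex_halfspace_Im_gt)
    show "F (subord w) - recip_cauchy_transform N w = 0" if "w \<in> H ` {S..}" for w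
    proof -
      obtain t where t: "t \<ge> S" "w = H t" using \<open>w \<in> H ` {S..}\<close> by auto
      have "recip_cauchy_transform N (H t) = F (\<i> * of_real t)" using T(2)[of t] t S by simp
      moreover from this have "subord (H t) = \<i> * of_real t"
        unfolding subord_def H_def using n_ge_1 by simp
      ultimately show ?thesis using t by simp
    qed
  qed (use assms ImH lim in \<open>auto simp: open_halfspace_Im_gt\<close>)
  then show ?thesis by simp
qed

lemma subord_equation:
  assumes "Im z > 0"
  shows "of_nat n * subord z - (of_nat n - 1) * F (subord z) = z"
  unfolding F_subord[OF assms] using n_ge_1 by (simp add: subord_def)

text \<open>Serves to recognize the root supplied by Brouwer's theorem: any solution in the upper
  half-plane is the value of \<open>subord\<close>.\<close>

lemma subord_unique:
  assumes "Im z > 0" "Im w > 0" "of_nat n * w - (of_nat n - 1) * F w = z"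
  shows "subord z = w"
  using subordination_inj[of "subord z" w] subord_equation[OF assms(1)] Im_subord_ge[OF assms(1)] assms by simp

end

section \<open>The argument part of the logarithmic potential\<close>

lemma Im_pos_not_nonpos_Real: "Im z > 0 \<Longrightarrow> z \<notin> \<real>\<^sub>\<le>\<^sub>0"
  by (auto simp: complex_nonpos_Reals_iff)

lemma Im_Ln_upper:
  assumes "Im z > 0"
  shows "0 < Im (Ln z)" "Im (Ln z) < pi"
  using Im_Ln_pos_lt[of z] assms by force+

lemma abs_Im_Ln_le_pi: "z \<noteq> 0 \<Longrightarrow> \<bar>Im (Ln z)\<bar> \<le> pi"
  using mpi_less_Im_Ln[of z] Im_Ln_le_pi[of z] by linarith

text \<open>Both arguments lie in (0, pi), so their difference lies in (-pi, pi) and no branch jump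
  occurs.\<close>

lemma Ln_divide_upper:
  assumes "Im z > 0" "Im w > 0"
  shows "Ln (w / z) = Ln w - Ln z"
proof (rule Ln_unique)
  have "z \<noteq> 0" "w \<noteq> 0" using assms by auto
  then show "exp (Ln w - Ln z) = w / z" by (simp add: exp_diff)
qed (use Im_Ln_upper[OF assms(1)] Im_Ln_upper[OF assms(2)] in auto)

lemma norm_Ln_one_plus_diff_le:
  assumes "cmod t \<le> 1 / 2"
  shows "cmod (Ln (1 + t) - t) \<le> 2 * (cmod t)\<^sup>2"
proof -
  have "cmod (Ln (1 + t) - t) \<le> (cmod t)\<^sup>2 / (1 - cmod t)" using assms by (intro Ln_approx_linear) auto
  also have "\<dots> \<le> (cmod t)\<^sup>2 / (1 / 2)" using assms by (intro divide_left_mono) auto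
  finally show ?thesis by simp
qed

context real_distribution
begin

text \<open>The imaginary part of the logarithmic potential \<open>\<integral> log (z - u)\<close>; on the real line it equals
  \<open>\<pi>\<close> times the upper tail. Unlike the potential itself it needs no moment condition.\<close>

definition mean_arg :: "complex \<Rightarrow> real" where
  "mean_arg z = (\<integral>u. Im (Ln (z - of_real u)) \<partial>M)"

lemma continuous_Im_Ln_diff: "Im z > 0 \<Longrightarrow> continuous_on UNIV (\<lambda>u. Im (Ln (z - of_real u)))"
  using Im_pos_not_nonpos_Real by (intro continuous_intros) auto

lemma integrable_Im_Ln_diff:
  assumes "Im z > 0"
  shows "integrable M (\<lambda>u. Im (Ln (z - of_real u)))"
proof (rule integrable_of_continuous_bounded[of _ pi])
  fix u show "norm (Im (Ln (z - of_real u))) \<le> pi" using Im_Ln_upper[of "z - of_real u"] assms by auto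
qed (use continuous_Im_Ln_diff assms in auto)

text \<open>\<open>mean_arg\<close> is locally the imaginary part of a primitive of the Cauchy
  transform. The increment is Ln (1 + t) with t = h / (z - u), whose quadratic remainder is uniform
  in \<open>u\<close>.\<close>

lemma has_derivative_mean_arg:
  assumes z: "Im z > 0"
  shows "(mean_arg has_derivative (\<lambda>h. Im (h * cauchy_transform M z))) (at z)"
proof (rule has_derivative_of_quadratic_bound[where r = "Im z / 2" and C = "2 / (Im z)\<^sup>2"])
  define f where "f = (\<lambda>u. 1 / (z - complex_of_real u))"
  have if': "integrable M f" unfolding f_def by (rule integrable_resolvent[OF z])
  fix h :: complex assume h: "norm h < Im z / 2"
  have "Im (z + h) \<ge> Im z / 2" using h abs_Im_le_cmod[of h] by auto
  then have zh: "Im (z + h) > 0" using z by linarith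
  let ?R = "\<lambda>u. Im (Ln (z + h - of_real u)) - Im (Ln (z - of_real u)) - Im (h * f u)"
  have bd: "norm (?R u) \<le> 2 / (Im z)\<^sup>2 * (norm h)\<^sup>2" for u
  proof -
    have "cmod (f u) \<le> 1 / Im z" unfolding f_def by (rule resolvent_bound[OF z])
    then have "cmod (h * f u) \<le> cmod h * (1 / Im z)" unfolding norm_mult by (intro mult_left_mono) auto
    then have t: "cmod (h * f u) \<le> cmod h / Im z" by simp
    also have "\<dots> \<le> 1 / 2" using h z by (simp add: field_simps)
    finally have t2: "cmod (h * f u) \<le> 1 / 2" .
    have "1 + h * f u = (z + h - of_real u) / (z - of_real u)"
      using diff_of_real_nonzero[OF z, of u] by (simp add: f_def field_simps)
    then have "Ln (1 + h * f u) = Ln (z + h - of_real u) - Ln (z - of_real u)"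
      using z zh Ln_divide_upper[of "z - of_real u" "z + h - of_real u"] by simp
    then have "?R u = Im (Ln (1 + h * f u) - h * f u)" by simp
    also have "norm \<dots> \<le> 2 * (cmod (h * f u))\<^sup>2"
      using norm_Ln_one_plus_diff_le[OF t2] abs_Im_le_cmod[of "Ln (1 + h * f u) - h * f u"] by simp
    also have "\<dots> \<le> 2 * (cmod h / Im z)\<^sup>2" using t by (intro mult_left_mono power_mono) auto
    finally show ?thesis by (simp add: power_divide)
  qed
  have "mean_arg (z + h) - mean_arg z - Im (h * cauchy_transform M z) = (\<integral>u. ?R u \<partial>M)"
  proof -
    have "h * cauchy_transform M z = (\<integral>u. h * f u \<partial>M)"
      unfolding cauchy_transform_def f_def by (rule integral_mult_right_zero[symmetric])
    moreover have i: "integrable M (\<lambda>u. h * f u)" using if' by (rule integrable_mult_right)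
    ultimately have "Im (h * cauchy_transform M z) = (\<integral>u. Im (h * f u) \<partial>M)"
      by (simp only: integral_Im[OF i])
    moreover have "integrable M (\<lambda>u. Im (h * f u))" using i by (rule integrable_Im)
    ultimately show ?thesis unfolding mean_arg_def
      using integrable_Im_Ln_diff[OF z] integrable_Im_Ln_diff[OF zh]
      by (simp only: Bochner_Integration.integral_diff Bochner_Integration.integrable_diff)
  qed
  then show "norm (mean_arg (z + h) - mean_arg z - Im (h * cauchy_transform M z)) \<le> 2 / (Im z)\<^sup>2 * (norm h)\<^sup>2"
    using norm_integral_le_const[OF bd] by simp
next
  show "bounded_linear (\<lambda>h. Im (h * cauchy_transform M z))"
    by (rule bounded_linear_compose[OF bounded_linear_Im bounded_linear_mult_left])
qed (use z in simp)

end

text \<open>At bounded distance from i (k + 1) the quotient by i (k + 1) tends to 1. These limits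
  fix the constant of integration in the argument formula.\<close>

lemma Im_Ln_tendsto_pi_half:
  assumes "\<And>k. Im (w k) > 0" "\<And>k. cmod (w k - \<i> * of_real (real (Suc k))) \<le> C"
  shows "(\<lambda>k. Im (Ln (w k))) \<longlonglongrightarrow> pi / 2"
proof -
  let ?i = "\<lambda>k. \<i> * of_real (real (Suc k))"
  have "(\<lambda>k. (w k - ?i k) / ?i k) \<longlonglongrightarrow> 0"
  proof (rule Lim_null_comparison)
    show "\<forall>\<^sub>F k in sequentially. norm ((w k - ?i k) / ?i k) \<le> C / real (Suc k)"
      using assms(2) by (intro always_eventually allI) (simp add: norm_divide norm_mult divide_right_mono del: of_nat_Suc)
    show "(\<lambda>k. C / real (Suc k)) \<longlonglongrightarrow> 0" using LIMSEQ_Suc[OF lim_const_over_n[of C]] by simp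
  qed
  then have "(\<lambda>k. 1 + (w k - ?i k) / ?i k) \<longlonglongrightarrow> 1 + 0" by (intro tendsto_add tendsto_const)
  then have "(\<lambda>k. w k / ?i k) \<longlonglongrightarrow> 1" by (simp add: diff_divide_distrib del: of_nat_Suc)
  then have "(\<lambda>k. Ln (w k / ?i k)) \<longlonglongrightarrow> Ln 1" by (intro tendsto_Ln) auto
  then have "(\<lambda>k. Im (Ln (w k / ?i k)) + pi / 2) \<longlonglongrightarrow> Im (Ln 1) + pi / 2"
    by (rule tendsto_add[OF tendsto_Im tendsto_const])
  moreover have "Im (Ln (w k / ?i k)) + pi / 2 = Im (Ln (w k))" for k
  proof -
    have "Im (Ln (?i k)) = pi / 2" by (subst Im_Ln_eq_pi_half) (auto simp del: of_nat_Suc)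
    then show ?thesis using assms(1) Ln_divide_upper[of "?i k" "w k"] by simp
  qed
  ultimately show ?thesis by simp
qed

lemma (in real_distribution) mean_arg_tendsto_pi_half:
  assumes "\<And>k. Im (w k) > 0" "\<And>k. cmod (w k - \<i> * of_real (real (Suc k))) \<le> C"
  shows "(\<lambda>k. mean_arg (w k)) \<longlonglongrightarrow> pi / 2"
proof -
  have "(\<lambda>k. \<integral>u. Im (Ln (w k - of_real u)) \<partial>M) \<longlonglongrightarrow> (\<integral>u. pi / 2 \<partial>M)"
  proof (rule integral_dominated_convergence[where w = "\<lambda>_. pi"])
    fix k
    show "AE u in M. norm (Im (Ln (w k - of_real u))) \<le> pi"
      using abs_Im_Ln_le_pi diff_of_real_nonzero[OF assms(1)[of k]] by (intro AE_I2) simp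
    show "(\<lambda>u. Im (Ln (w k - of_real u))) \<in> borel_measurable M"
      by (intro borel_measurable_of_continuous continuous_Im_Ln_diff assms)
  next
    show "AE u in M. (\<lambda>k. Im (Ln (w k - of_real u))) \<longlonglongrightarrow> pi / 2"
    proof (intro AE_I2 Im_Ln_tendsto_pi_half)
      fix u k
      show "cmod (w k - of_real u - \<i> * of_real (real (Suc k))) \<le> C + \<bar>u\<bar>"
        using norm_triangle_ineq4[of "w k - \<i> * of_real (real (Suc k))" "of_real u"] assms(2)[of k]
        by (simp add: algebra_simps del: of_nat_Suc)
    qed (use assms in auto)
  qed auto
  then show ?thesis by (simp add: mean_arg_def)
qed

section \<open>The argument formula for free powers\<close>

context free_power
begin

text \<open>By the subordination equation both displacements are multiples, by n - 1 and n, of the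
  defect at \<open>subord z\<close>, and \<open>subord z\<close> is at least as high as
  \<open>z\<close>.\<close>

lemma norm_subord_diff_le:
  assumes "Im z > 0"
  shows "cmod (subord z - z) \<le> real n / Im z"
    and "cmod (recip_cauchy_transform N z - z) \<le> real n / Im z"
proof -
  let ?E = "subord z - F (subord z)"
  have pos: "Im (subord z) > 0" using Im_subord_ge[OF assms] assms by linarith
  have "cmod ?E \<le> 1 / Im (subord z)" by (rule norm_defect_le[OF pos])
  also have "\<dots> \<le> 1 / Im z" using Im_subord_ge[OF assms] assms by (intro divide_left_mono) auto
  finally have E: "cmod ?E \<le> 1 / Im z" .
  have 1: "subord z - z = - of_real (real n - 1) * ?E"
    using subord_equation[OF assms] by (simp add: algebra_simps)
  have "cmod (subord z - z) = (real n - 1) * cmod ?E"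
    unfolding 1 norm_mult norm_minus_cancel norm_of_real using n_ge_1 by simp
  also have "\<dots> \<le> real n * (1 / Im z)" using E n_ge_1 by (intro mult_mono) auto
  finally show "cmod (subord z - z) \<le> real n / Im z" by simp
  have 2: "recip_cauchy_transform N z - z = - of_real (real n) * ?E"
    using 1 F_subord[OF assms] by (simp add: algebra_simps)
  have "cmod (recip_cauchy_transform N z - z) = real n * cmod ?E"
    unfolding 2 norm_mult norm_minus_cancel norm_of_real by simp
  also have "\<dots> \<le> real n * (1 / Im z)" using E by (intro mult_left_mono) auto
  finally show "cmod (recip_cauchy_transform N z - z) \<le> real n / Im z" by simp
qed

text \<open>Both sides have the same derivative \<open>h \<mapsto> Im (h G\<^sub>N z)\<close> and the same limit along the imaginary axis.\<close>

lemma mean_arg_subord: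
  assumes z: "Im z > 0"
  shows "N.mean_arg z = real n * mean_arg (subord z) - (real n - 1) * Im (Ln (recip_cauchy_transform N z))"
proof -
  let ?FN = "recip_cauchy_transform N"
  let ?U = "{z. Im z > 0}"
  define D where "D = (\<lambda>z. N.mean_arg z - (real n * mean_arg (subord z) - (real n - 1) * Im (Ln (?FN z))))"
  have FN_pos: "Im (?FN z) > 0" if "Im z > 0" for z
    using N.Im_recip_cauchy_transform_ge[OF that] that by linarith
  have S_pos: "Im (subord z) > 0" if "Im z > 0" for z
    using Im_subord_ge[OF that] that by linarith
  have deriv: "(D has_derivative (\<lambda>h. 0)) (at z)" if z: "Im z > 0" for z
  proof -
    define F' where "F' = deriv ?FN z"
    define S' where "S' = (1 + (of_nat n - 1) * F') / of_nat n"
    have dF: "(?FN has_field_derivative F') (at z)"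
      unfolding F'_def using N.holomorphic_recip_cauchy_transform z
      by (intro holomorphic_derivI[of _ ?U]) (auto simp: open_halfspace_Im_gt)
    have dS: "(subord has_field_derivative S') (at z)"
      unfolding subord_def[abs_def] S'_def using n_ge_1 by (auto intro!: derivative_eq_intros dF)
    have d1: "((\<lambda>z. mean_arg (subord z)) has_derivative (\<lambda>h. Im ((S' * h) * cauchy_transform M (subord z)))) (at z)"
      using has_derivative_compose[OF dS[unfolded has_field_derivative_def] has_derivative_mean_arg[OF S_pos[OF z]]] .
    have G: "cauchy_transform M (subord z) = 1 / ?FN z"
      using F_subord[OF z] cauchy_transform_recip[of "subord z"] by simp
    have "((\<lambda>z. Ln (?FN z)) has_field_derivative (1 / ?FN z) * F') (at z)"
      using DERIV_chain[OF has_field_derivative_Ln dF] Im_pos_not_nonpos_Real[OF FN_pos[OF z]] by (simp add: o_def divide_inverse)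
    then have "((\<lambda>z. Ln (?FN z)) has_derivative (\<lambda>h. (1 / ?FN z) * F' * h)) (at z)"
      unfolding has_field_derivative_def .
    then have d2: "((\<lambda>z. Im (Ln (?FN z))) has_derivative (\<lambda>h. Im ((1 / ?FN z) * F' * h))) (at z)"
      by (rule has_derivative_Im)
    have d3: "(N.mean_arg has_derivative (\<lambda>h. Im (h * (1 / ?FN z)))) (at z)"
      using N.has_derivative_mean_arg[OF z] by (simp add: N.cauchy_transform_recip)
    have "(D has_derivative (\<lambda>h. Im (h * (1 / ?FN z)) - (real n * Im ((S' * h) * (1 / ?FN z))
       - (real n - 1) * Im ((1 / ?FN z) * F' * h)))) (at z)"
      unfolding D_def using d1[unfolded G] d2 d3 by (intro has_derivative_diff has_derivative_mult_right)
    moreover have "Im (h * (1 / ?FN z)) - (real n * Im ((S' * h) * (1 / ?FN z)) - (real n - 1) * Im ((1 / ?FN z) * F' * h)) = 0" for h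
    proof -
      \<comment> \<open>This relation dictates the weights n and n - 1 of the formula: they make the
        derivative of F_N cancel and leave h / F_N.\<close>
      have nS: "of_real (real n) * S' = 1 + of_real (real n - 1) * F'" using n_ge_1 by (simp add: S'_def)
      have "h * g - (a * ((S' * h) * g) - b * (g * F' * h)) = 0" if "a * S' = 1 + b * F'" for a b g
      proof -
        have "a * ((S' * h) * g) = (a * S') * (h * g)" by (simp only: mult_ac)
        then show ?thesis unfolding that by (simp add: algebra_simps)
      qed
      note eq0 = this[OF nS, of "1 / ?FN z"]
      have Im_mult: "Im (complex_of_real a * w) = a * Im w" for a w by simp
      from eq0
      have "Im (h * (1 / ?FN z) - (of_real (real n) * ((S' * h) * (1 / ?FN z)) - of_real (real n - 1) * ((1 / ?FN z) * F' * h))) = 0"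
        by (simp only: zero_complex.sel)
      then show ?thesis by (simp only: minus_complex.sel Im_mult)
    qed
    ultimately show ?thesis by (simp only:)
  qed
  let ?i = "\<lambda>k. \<i> * of_real (real (Suc k))"
  have const: "D (?i k) = D z" for k
    by (rule has_derivative_zero_unique_connected[of ?U])
       (use deriv z in \<open>auto simp: open_halfspace_Im_gt intro: convex_connected convex_halfspace_Im_gt\<close>)
  have close: "real n / Im (?i k) \<le> real n" for k by (simp add: divide_le_eq mult_le_cancel_left1)
  have "(\<lambda>k. D (?i k)) \<longlonglongrightarrow> pi / 2 - (real n * (pi / 2) - (real n - 1) * (pi / 2))"
    unfolding D_def
  proof (intro tendsto_diff tendsto_mult tendsto_const)
    show "(\<lambda>k. N.mean_arg (?i k)) \<longlonglongrightarrow> pi / 2"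
      by (rule N.mean_arg_tendsto_pi_half[where C = 0]) auto
    show "(\<lambda>k. mean_arg (subord (?i k))) \<longlonglongrightarrow> pi / 2"
      by (rule mean_arg_tendsto_pi_half[where C = "real n"])
         (use order_trans[OF norm_subord_diff_le(1) close] S_pos in auto)
    show "(\<lambda>k. Im (Ln (?FN (?i k)))) \<longlonglongrightarrow> pi / 2"
      by (rule Im_Ln_tendsto_pi_half[where C = "real n"])
         (use order_trans[OF norm_subord_diff_le(2) close] FN_pos in auto)
  qed
  moreover have "b - (a * b - (a - 1) * b) = 0" for a b :: real by (simp add: algebra_simps)
  ultimately have "D z = 0" unfolding const by (simp only: LIMSEQ_const_iff)
  then show ?thesis by (simp add: D_def)
qed

end

text \<open>As the height tends to 0, the argument of x + iv - u tends to 0 for u < x, to pi for u >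
  x and to pi / 2 at u = x. An atom at x thus counts by half, which is why the limit is only
  enclosed between the open and the closed tail.\<close>

lemma (in real_distribution) mean_arg_boundary:
  assumes v: "v \<longlonglongrightarrow> 0" "\<And>k. v k > 0"
  obtains l where "(\<lambda>k. mean_arg (Complex x (v k))) \<longlonglongrightarrow> l" "pi * (1 - prob {..x}) \<le> l" "l \<le> pi * (1 - prob {..<x})"
proof -
  define h where "h u = (if u = x then pi / 2 else if u < x then 0 else pi)" for u
  have h_meas: "h \<in> borel_measurable M" unfolding h_def by (auto intro!: measurable_If)
  have pt: "(\<lambda>k. Im (Ln (Complex x (v k) - of_real u))) \<longlonglongrightarrow> h u" for u
  proof -
    \<comment> \<open>Dividing by i rotates the upper half-plane into the right one, away from the
      branch cut that the limit would otherwise hit for u > x.\<close>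
    have eq: "Im (Ln (Complex x (v k) - of_real u)) = Im (Ln (Complex (v k) (u - x))) + pi / 2" for k
    proof -
      have "(Complex x (v k) - of_real u) / \<i> = Complex (v k) (u - x)"
        by (simp add: complex_eq_iff Re_divide Im_divide)
      moreover have "Im (Ln \<i>) = pi / 2" by simp
      ultimately show ?thesis using Ln_divide_upper[of \<i> "Complex x (v k) - of_real u"] v(2)[of k] by simp
    qed
    have "(\<lambda>k. Im (Ln (Complex (v k) (u - x)))) \<longlonglongrightarrow> h u - pi / 2"
    proof (cases "u = x")
      case True
      have "Im (Ln (Complex (v k) 0)) = 0" for k
        using v(2)[of k] by (subst Im_Ln_eq_0) (auto simp: complex_eq_iff)
      then show ?thesis using True by (simp add: h_def)
    next
      case False
      have "(\<lambda>k. Complex (v k) (u - x)) \<longlonglongrightarrow> Complex 0 (u - x)" by (intro tendsto_intros v)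
      then have "(\<lambda>k. Ln (Complex (v k) (u - x))) \<longlonglongrightarrow> Ln (Complex 0 (u - x))"
        using False by (intro tendsto_Ln) (auto simp: complex_nonpos_Reals_iff)
      then have "(\<lambda>k. Im (Ln (Complex (v k) (u - x)))) \<longlonglongrightarrow> Im (Ln (Complex 0 (u - x)))" by (rule tendsto_Im)
      moreover have "Im (Ln (Complex 0 (u - x))) = h u - pi / 2"
      proof (cases "u < x")
        case True
        have "Im (Ln (Complex 0 (u - x))) = - pi / 2"
          using True by (subst Im_Ln_eq_pi_half) (auto simp: complex_eq_iff)
        then show ?thesis using True by (simp add: h_def)
      next
        case u: False
        have "Im (Ln (Complex 0 (u - x))) = pi / 2"
          using False u by (subst Im_Ln_eq_pi_half) (auto simp: complex_eq_iff)
        then show ?thesis using False u by (simp add: h_def)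
      qed
      ultimately show ?thesis by simp
    qed
    from tendsto_add[OF this tendsto_const[of "pi / 2"]] show ?thesis unfolding eq by simp
  qed
  have lim: "(\<lambda>k. mean_arg (Complex x (v k))) \<longlonglongrightarrow> (\<integral>u. h u \<partial>M)"
    unfolding mean_arg_def
  proof (rule integral_dominated_convergence[where w = "\<lambda>_. pi"])
    fix k
    show "AE u in M. norm (Im (Ln (Complex x (v k) - of_real u))) \<le> pi"
      using abs_Im_Ln_le_pi diff_of_real_nonzero[of "Complex x (v k)"] v(2)[of k] by (intro AE_I2) simp
    show "(\<lambda>u. Im (Ln (Complex x (v k) - of_real u))) \<in> borel_measurable M"
      by (intro borel_measurable_of_continuous continuous_Im_Ln_diff) (use v in auto)
  qed (use pt h_meas in auto)
  have ih: "integrable M h"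
    by (rule integrable_const_bound[of _ pi]) (auto simp: h_def[abs_def] h_meas[unfolded h_def[abs_def]])
  have compl: "prob (- A) = 1 - prob A" if "A \<in> sets borel" for A
    using prob_compl[of A] that by (simp add: Compl_eq_Diff_UNIV)
  have ii: "integrable M (\<lambda>u. pi * indicator A u)" if "A \<in> sets borel" for A
    by (intro integrable_mult_right integrable_real_indicator) (use that in \<open>auto simp: less_top[symmetric]\<close>)
  have "pi * (1 - prob {..x}) = (\<integral>u. pi * indicator {x<..} u \<partial>M)"
    using compl[of "{..x}"] by (simp add: Compl_atMost)
  also have "\<dots> \<le> (\<integral>u. h u \<partial>M)"
    by (intro integral_mono ih ii) (auto simp: h_def split: split_indicator)
  finally have lower: "pi * (1 - prob {..x}) \<le> (\<integral>u. h u \<partial>M)" .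
  have "(\<integral>u. h u \<partial>M) \<le> (\<integral>u. pi * indicator {x..} u \<partial>M)"
    by (intro integral_mono ih ii) (auto simp: h_def split: split_indicator)
  also have "\<dots> = pi * (1 - prob {..<x})"
    using compl[of "{..<x}"] by (simp add: Compl_lessThan)
  finally show thesis by (rule that[OF lim lower])
qed

section \<open>The semicircle distribution function\<close>

lemma semicircle_cdf_cos:
  assumes "0 \<le> \<phi>" "\<phi> \<le> pi"
  shows "semicircle_cdf (2 * cos \<phi>) = 1 - (\<phi> - sin \<phi> * cos \<phi>) / pi"
proof -
  \<comment> \<open>Antiderivative of the density on (-2, 2). The interior form of the fundamental
    theorem is applied to it because the derivative rules for sqrt and arcsin break down at -2 and
    2.\<close>
  define W where "W x = x * sqrt (4 - x\<^sup>2) / (4 * pi) + arcsin (x / 2) / pi" for x :: real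
  define x where "x = 2 * cos \<phi>"
  have x: "-2 \<le> x" "x \<le> 2" unfolding x_def using cos_ge_minus_one[of \<phi>] cos_le_one[of \<phi>] by auto
  have deriv: "(W has_vector_derivative semicircle_density y) (at y)" if "y \<in> {-2<..<x}" for y
  proof -
    have y: "-2 < y" "y < 2" using that x by auto
    then have "\<bar>y\<bar> < 2" by auto
    then have "y\<^sup>2 < 2\<^sup>2" by (metis abs_ge_zero power2_abs power_strict_mono zero_less_numeral)
    then have pos: "4 - y\<^sup>2 > 0" by simp
    define s where "s = sqrt (4 - y\<^sup>2)"
    have s: "s > 0" "s\<^sup>2 = 4 - y\<^sup>2" using pos by (auto simp: s_def)
    have s2: "sqrt (1 - (y / 2)\<^sup>2) = s / 2"
    proof (rule real_sqrt_unique)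
      show "(s / 2)\<^sup>2 = 1 - (y / 2)\<^sup>2" using s(2) by (simp add: power_divide field_simps)
    qed (use s in simp)
    have "(W has_real_derivative ((sqrt (4 - y\<^sup>2) + y * (inverse (sqrt (4 - y\<^sup>2)) / 2 * (- (2 * y)))) / (4 * pi)
        + (inverse (sqrt (1 - (y / 2)\<^sup>2)) * (1 / 2)) / pi)) (at y)"
      unfolding W_def[abs_def] using y pos
      by (auto intro!: derivative_eq_intros simp: power2_eq_square diff_divide_distrib algebra_simps)
    also have "(sqrt (4 - y\<^sup>2) + y * (inverse (sqrt (4 - y\<^sup>2)) / 2 * (- (2 * y)))) / (4 * pi)
        + (inverse (sqrt (1 - (y / 2)\<^sup>2)) * (1 / 2)) / pi = semicircle_density y"
    proof -
      have "(s + y * (inverse s / 2 * (- (2 * y)))) / (4 * pi) + inverse (s / 2) * (1 / 2) / pi = (s\<^sup>2 - y\<^sup>2 + 4) / (4 * pi * s)"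
        using s(1) by (simp add: field_simps power2_eq_square)
      also have "\<dots> = 2 * s\<^sup>2 / (4 * pi * s)" using s(2) by simp
      also have "\<dots> = 1 / (2 * pi) * s" using s(1) by (simp add: power2_eq_square)
      finally show ?thesis using pos unfolding s2 semicircle_density_def by (simp add: s_def max_def)
    qed
    finally show ?thesis by (simp add: has_real_derivative_iff_has_vector_derivative)
  qed
  have cont: "continuous_on {-2..x} W"
    unfolding W_def using x by (intro continuous_intros) auto
  have "(semicircle_density has_integral (W x - W (-2))) {-2..x}"
    using fundamental_theorem_of_calculus_interior[OF _ cont deriv] x by simp
  moreover have "set_integrable lborel {-2..x} semicircle_density"
    unfolding semicircle_density_def[abs_def]
    by (intro borel_integrable_atLeastAtMost' continuous_intros)
  ultimately have "(LBINT u:{-2..x}. semicircle_density u) = W x - W (-2)"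
    using set_borel_integral_eq_integral(2) integral_unique by metis
  moreover have "indicator {..x} u *\<^sub>R semicircle_density u = indicator {-2..x} u *\<^sub>R semicircle_density u" for u
  proof (cases "u < -2")
    case True
    then have "2\<^sup>2 \<le> (- u)\<^sup>2" by (intro power_mono) auto
    then have "semicircle_density u = 0" by (simp add: semicircle_density_def max_def)
    then show ?thesis by simp
  qed (auto split: split_indicator)
  ultimately have 1: "semicircle_cdf x = W x - W (-2)"
    unfolding semicircle_cdf_def set_lebesgue_integral_def by (simp only:)
  have "sin \<phi> \<ge> 0" using assms by (intro sin_ge_zero)
  moreover have "4 - x\<^sup>2 = (2 * sin \<phi>)\<^sup>2" unfolding x_def by (simp add: power_mult_distrib sin_squared_eq)
  ultimately have r: "sqrt (4 - x\<^sup>2) = 2 * sin \<phi>" by (intro real_sqrt_unique) auto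
  have A: "arcsin (x / 2) = pi / 2 - \<phi>"
  proof (rule arcsin_unique)
    show "sin (pi / 2 - \<phi>) = x / 2" by (simp add: x_def cos_sin_eq)
  qed (use assms in auto)
  have "W x = x * (2 * sin \<phi>) / (4 * pi) + (pi / 2 - \<phi>) / pi" unfolding W_def r A ..
  moreover have "W (-2) = - 1 / 2" by (simp add: W_def)
  ultimately have "W x - W (-2) = 1 - (\<phi> - sin \<phi> * cos \<phi>) / pi"
    by (simp only:) (simp add: x_def field_simps)
  then show ?thesis using 1 by (simp add: x_def)
qed

lemma semicircle_density_nonneg: "semicircle_density u \<ge> 0"
  by (simp add: semicircle_density_def)

lemma set_integrable_semicircle_density: "set_integrable lborel A semicircle_density" if "A \<in> sets borel"
proof -
  have "set_integrable lborel {-2..2} semicircle_density"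
    unfolding semicircle_density_def[abs_def]
    by (intro borel_integrable_atLeastAtMost' continuous_intros)
  moreover have "indicator {-2..2} u *\<^sub>R semicircle_density u = semicircle_density u" for u
  proof (cases "u \<in> {-2..2}")
    case False
    then have "2\<^sup>2 \<le> \<bar>u\<bar>\<^sup>2" by (intro power_mono) auto
    then have "semicircle_density u = 0" by (simp add: semicircle_density_def max_def)
    then show ?thesis by simp
  qed simp
  ultimately have "integrable lborel semicircle_density"
    unfolding set_integrable_def by (simp only:)
  then show ?thesis using that unfolding set_integrable_def
    by (intro integrable_mult_indicator) auto
qed

lemma mono_semicircle_cdf: "x \<le> y \<Longrightarrow> semicircle_cdf x \<le> semicircle_cdf y"
  unfolding semicircle_cdf_def set_lebesgue_integral_def
  using set_integrable_semicircle_density semicircle_density_nonneg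
  by (intro integral_mono) (auto simp: set_integrable_def split: split_indicator)

lemma semicircle_cdf_bounds: "0 \<le> semicircle_cdf x" "semicircle_cdf x \<le> 1"
proof -
  show "0 \<le> semicircle_cdf x"
    unfolding semicircle_cdf_def set_lebesgue_integral_def using semicircle_density_nonneg by simp
  show "semicircle_cdf x \<le> 1"
  proof (cases "x \<le> 2")
    case True
    then show ?thesis using mono_semicircle_cdf[of x 2] semicircle_cdf_cos[of 0] by simp
  next
    case False
    have "indicator {..x} u *\<^sub>R semicircle_density u = indicator {..2} u *\<^sub>R semicircle_density u" for u
    proof (cases "u > 2")
      case True
      then have "2\<^sup>2 \<le> u\<^sup>2" by (intro power_mono) auto
      then have "semicircle_density u = 0" by (simp add: semicircle_density_def max_def)
      then show ?thesis by simp
    qed (use False in \<open>auto split: split_indicator\<close>)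
    then have "semicircle_cdf x = semicircle_cdf 2"
      unfolding semicircle_cdf_def set_lebesgue_integral_def by (simp only:)
    then show ?thesis using semicircle_cdf_cos[of 0] by simp
  qed
qed

text \<open>The left side is pi times the semicircle mass above 2 cos phi. Up to pi / 3 the
  difference of the two sides has derivative sin^2 (9 cos - 2), nonnegative as cos \<ge> 1/2; beyond
  pi / 3 the right side already exceeds pi / 2.\<close>

lemma angle_defect_le_sin_cubed:
  assumes "0 \<le> \<phi>" "\<phi> \<le> pi / 2"
  shows "\<phi> - sin \<phi> * cos \<phi> \<le> 3 * sin \<phi> ^ 3"
proof (cases "\<phi> \<le> pi / 3")
  case True
  have "3 * sin 0 ^ 3 - (0 - sin 0 * cos 0) \<le> 3 * sin \<phi> ^ 3 - (\<phi> - sin \<phi> * cos (\<phi>::real))"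
  proof (rule DERIV_nonneg_imp_nondecreasing[OF assms(1)])
    fix y :: real assume y: "0 \<le> y" "y \<le> \<phi>"
    have "((\<lambda>y. 3 * sin y ^ 3 - (y - sin y * cos y)) has_real_derivative
        (3 * (3 * sin y ^ 2 * cos y) - (1 - (cos y * cos y - sin y * sin y)))) (at y)"
      by (auto intro!: derivative_eq_intros simp: power2_eq_square)
    moreover have "3 * (3 * sin y ^ 2 * cos y) - (1 - (cos y * cos y - sin y * sin y)) \<ge> 0"
    proof -
      have c: "cos y \<ge> 1 / 2" using cos_monotone_0_pi_le[of y "pi / 3"] y True by (simp add: cos_60)
      have "1 - cos y * cos y = sin y ^ 2" using sin_squared_eq[of y] by (simp add: power2_eq_square)
      then have "3 * (3 * sin y ^ 2 * cos y) - (1 - (cos y * cos y - sin y * sin y)) = sin y ^ 2 * (9 * cos y - 2)"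
        by (simp add: power2_eq_square algebra_simps)
      also have "\<dots> \<ge> 0" using c by (intro mult_nonneg_nonneg) auto
      finally show ?thesis .
    qed
    ultimately show "\<exists>D. ((\<lambda>y. 3 * sin y ^ 3 - (y - sin y * cos y)) has_real_derivative D) (at y) \<and> 0 \<le> D" by blast
  qed
  then show ?thesis by simp
next
  case False
  have s: "sin \<phi> \<ge> sqrt 3 / 2"
    using sin_monotone_2pi_le[of "pi / 3" \<phi>] False assms by (simp add: sin_60)
  have "sin \<phi> ^ 2 \<ge> 3 / 4" using power_mono[OF s, of 2] by (simp add: power_divide)
  moreover have "sqrt 3 \<ge> 17 / 10" by (rule real_le_rsqrt) (simp add: power2_eq_square)
  then have "sin \<phi> \<ge> 17 / 20" using s by linarith
  ultimately have "(3 / 4) * (17 / 20) \<le> sin \<phi> ^ 2 * sin \<phi>" by (intro mult_mono) auto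
  then have "sin \<phi> ^ 3 \<ge> 51 / 80" by (simp add: power2_eq_square power3_eq_cube)
  moreover have "pi / 2 \<le> 3 * (51 / 80)" using pi_less_4 pi_approx by simp
  moreover have "sin \<phi> * cos \<phi> \<ge> 0" using assms by (intro mult_nonneg_nonneg sin_ge_zero cos_ge_zero) auto
  ultimately show ?thesis using assms by linarith
qed

section \<open>Expansions under a moment condition\<close>

text \<open>The remainder vanishes at 0 and has derivative -w^2 / (1 - w), at most 2 |t|^2 in
  modulus on the disc of radius |t|.\<close>

lemma norm_Ln_one_minus_second_order_le:
  assumes "cmod t \<le> 1 / 2"
  shows "cmod (Ln (1 - t) + t + t\<^sup>2 / 2) \<le> 2 * cmod t ^ 3"
proof -
  let ?S = "cball (0::complex) (cmod t)"
  let ?h = "\<lambda>t. Ln (1 - t) + t + t\<^sup>2 / 2"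
  have "cmod (?h t - ?h 0) \<le> 2 * (cmod t)\<^sup>2 * cmod (t - 0)"
  proof (rule field_differentiable_bound[where S = ?S and f' = "\<lambda>w. - w\<^sup>2 / (1 - w)"])
    fix w assume "w \<in> ?S"
    then have w: "cmod w \<le> cmod t" by simp
    then have "Re w \<le> 1 / 2" using assms complex_Re_le_cmod[of w] by linarith
    then have Re: "Re (1 - w) > 0" by simp
    then have "w \<noteq> 1" by auto
    moreover have "1 - w \<notin> \<real>\<^sub>\<le>\<^sub>0" using Re by (auto simp: complex_nonpos_Reals_iff)
    ultimately show "(?h has_field_derivative - w\<^sup>2 / (1 - w)) (at w within ?S)"
      by (auto intro!: derivative_eq_intros simp: field_simps power2_eq_square)
    have "1 / 2 \<le> cmod (1 - w)" using norm_triangle_ineq2[of 1 w] w assms by simp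
    moreover have "cmod (w\<^sup>2) \<le> (cmod t)\<^sup>2" using w by (simp add: norm_power power_mono)
    ultimately have "cmod (w\<^sup>2) / cmod (1 - w) \<le> (cmod t)\<^sup>2 / (1 / 2)" by (intro frac_le) auto
    then show "cmod (- w\<^sup>2 / (1 - w)) \<le> 2 * (cmod t)\<^sup>2" by (simp add: norm_divide norm_power)
  qed auto
  then show ?thesis by (simp add: power2_eq_square power3_eq_cube)
qed

text \<open>For \<open>|u| > |z| / 2\<close> only the boundedness of the argument is used, which makes the bound
  insensitive to the distance of \<open>z\<close> from the real line.\<close>

lemma Im_Ln_diff_second_order_le:
  assumes z: "Im z > 0" and q: "2 < q" "q \<le> 3"
  shows "\<bar>Im (Ln (z - of_real u)) - Im (Ln z) + Im (of_real u / z + (of_real u)\<^sup>2 / (2 * z\<^sup>2))\<bar>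
    \<le> 40 * (\<bar>u\<bar> / cmod z) powr q"
proof -
  define t where "t = of_real u / z"
  define r where "r = \<bar>u\<bar> / cmod z"
  have z0: "z \<noteq> 0" using z by auto
  have tr: "cmod t = r" by (simp add: t_def r_def norm_divide)
  have r0: "r \<ge> 0" by (simp add: r_def)
  have e: "of_real u / z + (of_real u)\<^sup>2 / (2 * z\<^sup>2) = t + t\<^sup>2 / 2" by (simp add: t_def power_divide)
  have "\<bar>Im (Ln (z - of_real u)) - Im (Ln z) + Im (t + t\<^sup>2 / 2)\<bar> \<le> 40 * r powr q"
  proof (cases "r \<le> 1 / 2")
    case True
    have "1 - t = (z - of_real u) / z" using z0 by (simp add: t_def field_simps)
    then have "Ln (1 - t) = Ln (z - of_real u) - Ln z"
      using Ln_divide_upper[of z "z - of_real u"] z by simp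
    then have "Im (Ln (z - of_real u)) - Im (Ln z) + Im (t + t\<^sup>2 / 2) = Im (Ln (1 - t) + t + t\<^sup>2 / 2)" by simp
    also have "\<bar>\<dots>\<bar> \<le> 2 * r ^ 3"
      using norm_Ln_one_minus_second_order_le[of t] abs_Im_le_cmod[of "Ln (1 - t) + t + t\<^sup>2 / 2"] True tr by simp
    also have "r ^ 3 \<le> r powr q"
    proof (cases "r = 0")
      case False
      then have "r ^ 3 = r powr 3" using r0 by (simp add: powr_numeral)
      also have "\<dots> \<le> r powr q" using False r0 True q by (intro powr_mono') auto
      finally show ?thesis .
    qed simp
    finally show ?thesis using powr_ge_zero[of r q] by linarith
  next
    case False
    then have r: "r > 1 / 2" by simp
    have "\<bar>Im (Ln (z - of_real u))\<bar> \<le> pi" "\<bar>Im (Ln z)\<bar> \<le> pi"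
      "0 < Im (Ln (z - of_real u))" "0 < Im (Ln z)"
      using Im_Ln_upper[of "z - of_real u"] Im_Ln_upper[of z] z by auto
    then have 1: "\<bar>Im (Ln (z - of_real u)) - Im (Ln z)\<bar> \<le> 4" using pi_less_4 by linarith
    have "\<bar>Im (t + t\<^sup>2 / 2)\<bar> \<le> cmod (t + t\<^sup>2 / 2)" by (rule abs_Im_le_cmod)
    also have "\<dots> \<le> r + r\<^sup>2 / 2" using norm_triangle_ineq[of t "t\<^sup>2 / 2"] by (simp add: tr norm_divide norm_power)
    finally have 2: "\<bar>Im (t + t\<^sup>2 / 2)\<bar> \<le> r + r\<^sup>2 / 2" .
    have "1 \<le> (2 * r)\<^sup>2" using r power_mono[of 1 "2 * r" 2] by simp
    then have 3: "1 \<le> 4 * r\<^sup>2" by (simp add: power_mult_distrib)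
    have "r * (1 / 2) \<le> r * r" using r by (intro mult_left_mono) auto
    then have 4: "r \<le> 2 * r\<^sup>2" by (simp add: power2_eq_square)
    \<comment> \<open>As 2 r > 1, raising the exponent from 2 to q only helps, and q \<le> 3 gives
      r^2 \<le> 2 r^q. In total 4 + r + r^2 / 2 \<le> 37/2 r^2 \<le> 37 r^q.\<close>
    have "(2 * r) powr 2 \<le> (2 * r) powr q" using r q by (intro powr_mono) auto
    then have "4 * r\<^sup>2 \<le> 2 powr q * r powr q" using r by (simp add: powr_mult power_mult_distrib)
    also have "\<dots> \<le> 2 powr 3 * r powr q" using q by (intro mult_right_mono powr_mono) auto
    finally have 5: "r\<^sup>2 \<le> 2 * r powr q" by simp
    show ?thesis using 1 2 3 4 5 by linarith
  qed
  then show ?thesis unfolding e r_def .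
qed

text \<open>The difference is u^3 / (z (z - u)). For |u| \<le> 2 |z| the surplus |u|^(3 - q) is
  traded for |z|^(3 - q); for larger |u| one has |z - u| \<ge> |u| / 2, and the surplus |u|^(2 - q)
  has a negative exponent.\<close>

lemma norm_square_resolvent_diff_le:
  assumes z: "Im z > 0" and q: "2 < q" "q \<le> 3"
  shows "cmod ((of_real u)\<^sup>2 / (z - of_real u) - (of_real u)\<^sup>2 / z) \<le> 2 * cmod z powr (2 - q) / Im z * \<bar>u\<bar> powr q"
proof (cases "u = 0")
  case False
  have z0: "z \<noteq> 0" "cmod z > 0" using z by auto
  have zu: "z - of_real u \<noteq> 0" by (rule diff_of_real_nonzero[OF z])
  have "(of_real u)\<^sup>2 / (z - of_real u) - (of_real u)\<^sup>2 / z = (of_real u) ^ 3 / (z * (z - of_real u))"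
    using z0 zu by (simp add: field_simps power2_eq_square power3_eq_cube)
  then have "cmod ((of_real u)\<^sup>2 / (z - of_real u) - (of_real u)\<^sup>2 / z) = \<bar>u\<bar> ^ 3 / (cmod z * cmod (z - of_real u))"
    by (simp add: norm_divide norm_mult norm_power)
  also have "\<dots> \<le> 2 * cmod z powr (2 - q) / Im z * \<bar>u\<bar> powr q"
  proof (cases "\<bar>u\<bar> \<le> 2 * cmod z")
    case True
    have "\<bar>u\<bar> ^ 3 = \<bar>u\<bar> powr q * \<bar>u\<bar> powr (3 - q)" using False by (simp add: powr_add[symmetric] powr_numeral)
    also have "\<dots> \<le> \<bar>u\<bar> powr q * (2 * cmod z) powr (3 - q)"
      using True q by (intro mult_left_mono powr_mono2) auto
    also have "(2 * cmod z) powr (3 - q) = 2 powr (3 - q) * cmod z powr (1 + (2 - q))"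
      by (simp add: powr_mult)
    also have "\<dots> = 2 powr (3 - q) * (cmod z * cmod z powr (2 - q))"
      using z0 by (subst powr_add) simp
    also have "\<bar>u\<bar> powr q * \<dots> \<le> \<bar>u\<bar> powr q * (2 powr 1 * (cmod z * cmod z powr (2 - q)))"
      using q by (intro mult_left_mono mult_right_mono powr_mono) auto
    finally have "\<bar>u\<bar> ^ 3 \<le> 2 * \<bar>u\<bar> powr q * cmod z * cmod z powr (2 - q)" by simp
    then have "\<bar>u\<bar> ^ 3 / (cmod z * cmod (z - of_real u)) \<le> 2 * \<bar>u\<bar> powr q * cmod z * cmod z powr (2 - q) / (cmod z * Im z)"
      using z z0 norm_diff_of_real_ge[OF z] by (intro frac_le mult_left_mono) auto
    then show ?thesis using z0 by (simp add: mult_ac)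
  next
    case u: False
    have "\<bar>u\<bar> \<le> 2 * cmod (z - of_real u)" using u norm_triangle_ineq3[of "of_real u" z] by (simp add: norm_minus_commute)
    then have "\<bar>u\<bar> ^ 3 / (cmod z * cmod (z - of_real u)) \<le> \<bar>u\<bar> ^ 3 / (Im z * (\<bar>u\<bar> / 2))"
      using z z0 False abs_Im_le_cmod[of z] by (intro frac_le mult_mono) auto
    also have "\<dots> = 2 * \<bar>u\<bar>\<^sup>2 / Im z" using False by (simp add: power2_eq_square power3_eq_cube)
    also have "\<dots> \<le> 2 * (\<bar>u\<bar> powr q * cmod z powr (2 - q)) / Im z"
    proof -
      have "\<bar>u\<bar>\<^sup>2 = \<bar>u\<bar> powr q * \<bar>u\<bar> powr (2 - q)" using False by (simp add: powr_add[symmetric] powr_numeral)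
      also have "\<dots> \<le> \<bar>u\<bar> powr q * cmod z powr (2 - q)"
        using u q z0 by (intro mult_left_mono powr_mono2') auto
      finally show ?thesis using z by (intro divide_right_mono mult_left_mono) auto
    qed
    finally show ?thesis by (simp add: mult_ac)
  qed
  finally show ?thesis .
qed (use assms in simp)

section \<open>Integrated expansions of the argument and of the defect\<close>

context standardized_distribution
begin

text \<open>Young's inequality with the conjugate exponents q / 2 and q / (q - 2), integrated and
  compared with the second moment 1.\<close>

lemma abs_moment_ge_1:
  assumes "integrable M (\<lambda>u. \<bar>u\<bar> powr q)" "2 < q"
  shows "abs_moment q M \<ge> 1"
proof -
  have pt: "u\<^sup>2 \<le> (2 / q) * \<bar>u\<bar> powr q + (1 - 2 / q)" for u :: real
  proof -
    have "u\<^sup>2 * 1 \<le> (u\<^sup>2) powr (q / 2) / (q / 2) + 1 powr (q / (q - 2)) / (q / (q - 2))"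
      by (rule Youngs_inequality) (use assms(2) in \<open>auto simp: field_simps\<close>)
    moreover have "(u\<^sup>2) powr (q / 2) = \<bar>u\<bar> powr q"
    proof (cases "u = 0")
      case False
      then have *: "u\<^sup>2 = \<bar>u\<bar> powr 2" by (simp add: powr_numeral)
      show ?thesis unfolding * powr_powr by simp
    qed (use assms in auto)
    ultimately show ?thesis using assms(2) by (simp add: field_simps)
  qed
  have "1 = (\<integral>u. u\<^sup>2 \<partial>M)" by (simp add: variance_one)
  also have "\<dots> \<le> (\<integral>u. (2 / q) * \<bar>u\<bar> powr q + (1 - 2 / q) \<partial>M)"
    by (rule integral_mono[OF integrable_square _ pt]) (use assms in auto)
  also have "\<dots> = (2 / q) * abs_moment q M + (1 - 2 / q)"
    using assms by (simp add: abs_moment_def)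
  finally have "2 / q * 1 \<le> 2 / q * abs_moment q M" by simp
  then show ?thesis using assms(2) by (subst (asm) mult_le_cancel_left_pos) auto
qed

lemma mean_arg_expansion:
  assumes z: "Im z > 0" and q: "2 < q" "q \<le> 3" "integrable M (\<lambda>u. \<bar>u\<bar> powr q)"
  shows "\<bar>mean_arg z - Im (Ln z) + Im (1 / (2 * z\<^sup>2))\<bar> \<le> 40 * abs_moment q M / cmod z powr q"
proof -
  let ?R = "\<lambda>u. Im (Ln (z - of_real u)) - Im (Ln z) + Im (of_real u / z + (of_real u)\<^sup>2 / (2 * z\<^sup>2))"
  have iu: "integrable M (\<lambda>u. complex_of_real u)" using integrable_id by (simp add: integrable_of_real)
  have iu2: "integrable M (\<lambda>u. (complex_of_real u)\<^sup>2)"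
    using integrable_of_real[OF integrable_square, where 'a = complex] by simp
  have i: "integrable M (\<lambda>u. complex_of_real u / z + (of_real u)\<^sup>2 / (2 * z\<^sup>2))"
    using iu iu2 by (intro Bochner_Integration.integrable_add integrable_divide_zero) auto
  have "(\<integral>u. complex_of_real u / z + (of_real u)\<^sup>2 / (2 * z\<^sup>2) \<partial>M) = (\<integral>u. complex_of_real u \<partial>M) / z + (\<integral>u. (complex_of_real u)\<^sup>2 \<partial>M) / (2 * z\<^sup>2)"
    using iu iu2 by simp
  also have "(\<integral>u. complex_of_real u \<partial>M) = 0" by (simp add: mean_zero)
  also have "(\<integral>u. (complex_of_real u)\<^sup>2 \<partial>M) = 1"
    using integral_of_real[OF integrable_square, where 'a = complex] by (simp add: variance_one)
  finally have int: "(\<integral>u. complex_of_real u / z + (of_real u)\<^sup>2 / (2 * z\<^sup>2) \<partial>M) = 1 / (2 * z\<^sup>2)" by simp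
  have I: "(\<integral>u. Im (complex_of_real u / z + (of_real u)\<^sup>2 / (2 * z\<^sup>2)) \<partial>M) = Im (1 / (2 * z\<^sup>2))"
    unfolding int[symmetric] by (rule integral_Im[OF i])
  have iI: "integrable M (\<lambda>u. Im (complex_of_real u / z + (of_real u)\<^sup>2 / (2 * z\<^sup>2)))"
    by (rule integrable_Im[OF i])
  have "(\<integral>u. ?R u \<partial>M) = (\<integral>u. Im (Ln (z - of_real u)) - Im (Ln z) \<partial>M)
      + (\<integral>u. Im (complex_of_real u / z + (of_real u)\<^sup>2 / (2 * z\<^sup>2)) \<partial>M)"
    by (rule Bochner_Integration.integral_add[OF _ iI]) (use integrable_Im_Ln_diff[OF z] in auto)
  also have "\<dots> = mean_arg z - Im (Ln z) + Im (1 / (2 * z\<^sup>2))"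
    unfolding I mean_arg_def using integrable_Im_Ln_diff[OF z] by simp
  finally have eq: "mean_arg z - Im (Ln z) + Im (1 / (2 * z\<^sup>2)) = (\<integral>u. ?R u \<partial>M)" ..
  have "\<bar>\<integral>u. ?R u \<partial>M\<bar> \<le> (\<integral>u. \<bar>?R u\<bar> \<partial>M)" by (rule integral_abs_bound)
  also have "\<dots> \<le> (\<integral>u. 40 / cmod z powr q * \<bar>u\<bar> powr q \<partial>M)"
  proof (rule integral_mono_AE')
    show "AE u in M. \<bar>?R u\<bar> \<le> 40 / cmod z powr q * \<bar>u\<bar> powr q"
      using Im_Ln_diff_second_order_le[OF z q(1,2)] by (intro AE_I2) (simp add: powr_divide)
  qed (use q in auto)
  also have "\<dots> = 40 * abs_moment q M / cmod z powr q" by (simp add: abs_moment_def)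
  finally show ?thesis unfolding eq .
qed

text \<open>With E = z - F z and m the integral of u^2 / (z - u), the relations z^2 G = z + m and F
  G = 1 give z (E - m) = - E m. Both |E| and |m| are at most 1 / Im z, so E is m up to second order,
  and the q-th moment compares m with 1 / z.\<close>

lemma recip_cauchy_transform_defect_approx:
  assumes z: "Im z > 0" and q: "2 < q" "q \<le> 3" "integrable M (\<lambda>u. \<bar>u\<bar> powr q)"
  shows "cmod (z - recip_cauchy_transform M z - 1 / z)
    \<le> 2 * abs_moment q M * cmod z powr (2 - q) / Im z + 1 / ((Im z)\<^sup>2 * cmod z)"
proof -
  define m where "m u = (complex_of_real u)\<^sup>2 / (z - of_real u)" for u
  define E where "E = z - recip_cauchy_transform M z"
  let ?m = "\<integral>u. m u \<partial>M"
  have z0: "z \<noteq> 0" "cmod z > 0" using z by auto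
  have iu: "integrable M (\<lambda>u. complex_of_real u)" using integrable_id by (simp add: integrable_of_real)
  have iu2: "integrable M (\<lambda>u. (complex_of_real u)\<^sup>2)"
    using integrable_of_real[OF integrable_square, where 'a = complex] by simp
  have mb: "norm (m u) \<le> 1 / Im z * u\<^sup>2" for u
    using mult_right_mono[OF resolvent_bound[OF z, of u], of "u\<^sup>2"]
    by (simp add: m_def norm_divide norm_power)
  have im: "integrable M m"
  proof (rule Bochner_Integration.integrable_bound)
    show "integrable M (\<lambda>u. 1 / Im z * u\<^sup>2)" using integrable_square by simp
    show "m \<in> borel_measurable M" unfolding m_def[abs_def]
      by (intro borel_measurable_of_continuous continuous_intros) (use diff_of_real_nonzero[OF z] in auto)
    show "AE u in M. norm (m u) \<le> norm (1 / Im z * u\<^sup>2)" using mb by (intro AE_I2) (smt (verit) real_norm_def)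
  qed
  have "norm ?m \<le> (\<integral>u. norm (m u) \<partial>M)" by (rule integral_norm_bound)
  also have "\<dots> \<le> (\<integral>u. 1 / Im z * u\<^sup>2 \<partial>M)"
    by (rule integral_mono[OF integrable_norm[OF im] _ mb]) (use integrable_square in simp)
  also have "\<dots> = 1 / Im z" by (simp add: variance_one)
  finally have m_le: "norm ?m \<le> 1 / Im z" .
  have "z\<^sup>2 * (1 / (z - of_real u)) = z + of_real u + m u" for u
    using diff_of_real_nonzero[OF z, of u] by (simp add: m_def field_simps power2_eq_square)
  then have "(\<integral>u. z\<^sup>2 * (1 / (z - of_real u)) \<partial>M) = (\<integral>u. z + of_real u + m u \<partial>M)" by (simp only:)
  also have "\<dots> = z + (\<integral>u. complex_of_real u \<partial>M) + ?m"
    using iu im by simp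
  also have "(\<integral>u. complex_of_real u \<partial>M) = 0" by (simp add: mean_zero)
  also have "(\<integral>u. z\<^sup>2 * (1 / (z - of_real u)) \<partial>M) = z\<^sup>2 * cauchy_transform M z"
    unfolding cauchy_transform_def by (rule integral_mult_right_zero)
  finally have G: "z\<^sup>2 * cauchy_transform M z = z + ?m" by simp
  have FG: "recip_cauchy_transform M z * cauchy_transform M z = 1"
    using cauchy_transform_nonzero[OF z] by (simp add: recip_cauchy_transform_def)
  have "z\<^sup>2 = z\<^sup>2 * (recip_cauchy_transform M z * cauchy_transform M z)" by (simp add: FG)
  also have "\<dots> = (z - E) * (z + ?m)" unfolding E_def G[symmetric] by (simp add: algebra_simps)
  finally have "z * (E - ?m) = - (E * ?m)" by (simp add: algebra_simps power2_eq_square)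
  then have "cmod z * cmod (E - ?m) = cmod E * cmod ?m" by (metis norm_minus_cancel norm_mult)
  also have "\<dots> \<le> (1 / Im z) * (1 / Im z)"
    using norm_defect_le[OF z] m_le z unfolding E_def by (intro mult_mono) auto
  finally have 1: "cmod (E - ?m) \<le> 1 / ((Im z)\<^sup>2 * cmod z)"
    using z0 z by (simp add: field_simps power2_eq_square)
  have "(\<integral>u. (complex_of_real u)\<^sup>2 / z \<partial>M) = 1 / z"
    using integral_of_real[OF integrable_square, where 'a = complex] by (simp add: variance_one)
  then have "?m - 1 / z = (\<integral>u. m u - (of_real u)\<^sup>2 / z \<partial>M)" using im iu2 by simp
  also have "norm \<dots> \<le> (\<integral>u. norm (m u - (of_real u)\<^sup>2 / z) \<partial>M)" by (rule integral_norm_bound)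
  also have "\<dots> \<le> (\<integral>u. 2 * cmod z powr (2 - q) / Im z * \<bar>u\<bar> powr q \<partial>M)"
  proof (rule integral_mono_AE')
    show "AE u in M. norm (m u - (of_real u)\<^sup>2 / z) \<le> 2 * cmod z powr (2 - q) / Im z * \<bar>u\<bar> powr q"
      unfolding m_def using norm_square_resolvent_diff_le[OF z q(1,2)] by (intro AE_I2)
    show "AE u in M. 0 \<le> 2 * cmod z powr (2 - q) / Im z * \<bar>u\<bar> powr q" using z by simp
    show "integrable M (\<lambda>u. 2 * cmod z powr (2 - q) / Im z * \<bar>u\<bar> powr q)" using q by (intro integrable_mult_right)
  qed
  also have "\<dots> = 2 * abs_moment q M * cmod z powr (2 - q) / Im z" by (simp add: abs_moment_def)
  finally have 2: "cmod (?m - 1 / z) \<le> 2 * abs_moment q M * cmod z powr (2 - q) / Im z" .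
  have "cmod (E - 1 / z) \<le> cmod (E - ?m) + cmod (?m - 1 / z)"
    using norm_triangle_ineq[of "E - ?m" "?m - 1 / z"] by simp
  then show ?thesis using 1 2 unfolding E_def by linarith
qed

end

section \<open>Comparison with the semicircle law\<close>

locale lyapunov_free_power = free_power +
  fixes q :: real
  assumes q: "2 < q" "q \<le> 3"
    and integrable_powr: "integrable M (\<lambda>u. \<bar>u\<bar> powr q)"
begin

abbreviation "L \<equiv> lyapunov_fraction q M n"

text \<open>From \<beta>_q \<ge> 1 and q \<le> 3 one gets L \<ge> n^(-1/2). This is what allows
  every term of order 1 / n to be counted as L^2.\<close>

lemma inverse_n_le_L_square: "1 / real n \<le> L\<^sup>2" and L_pos: "L > 0"
proof -
  have n: "real n \<ge> 1" using n_ge_1 by simp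
  have b: "abs_moment q M \<ge> 1" by (rule abs_moment_ge_1[OF integrable_powr q(1)])
  have "real n powr ((q - 2) / 2) \<le> real n powr (1 / 2)" using q n by (intro powr_mono) auto
  then have "1 / real n powr (1 / 2) \<le> abs_moment q M / real n powr ((q - 2) / 2)"
    using n b by (intro frac_le) auto
  then have le: "1 / sqrt (real n) \<le> L" unfolding lyapunov_fraction_def using n by (simp add: powr_half_sqrt)
  moreover have s: "0 < 1 / sqrt (real n)" using n by simp
  ultimately show "L > 0" by linarith
  have "(1 / sqrt (real n))\<^sup>2 \<le> L\<^sup>2" using le s by (intro power_mono) auto
  then show "1 / real n \<le> L\<^sup>2" by (simp add: power_divide)
qed

text \<open>Homogeneity: the scale sqrt n of the argument turns the moment into the Lyapunov
  fraction, once in the argument expansion and once in the defect estimate.\<close>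

lemma scaled_moment:
  assumes "Z \<noteq> 0"
  shows "real n * (abs_moment q M / cmod (of_real (sqrt (real n)) * Z) powr q) = L / cmod Z powr q"
    and "sqrt (real n) * (abs_moment q M * cmod (of_real (sqrt (real n)) * Z) powr (2 - q)) / sqrt (real n)
      = L * cmod Z powr (2 - q)"
proof -
  have n: "real n > 0" using n_ge_1 by simp
  have c: "cmod (of_real (sqrt (real n)) * Z) = real n powr (1 / 2) * cmod Z"
    using n by (simp add: norm_mult powr_half_sqrt)
  have p: "(real n powr (1 / 2) * cmod Z) powr r = real n powr (r / 2) * cmod Z powr r" for r
    by (simp add: powr_mult powr_powr)
  have "real n / real n powr (q / 2) = real n powr (1 - q / 2)" using n by (simp add: powr_diff)
  also have "1 - q / 2 = - ((q - 2) / 2)" by (simp add: field_simps)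
  also have "real n powr \<dots> = 1 / real n powr ((q - 2) / 2)" by (simp add: powr_minus_divide)
  finally have e: "real n / real n powr (q / 2) = 1 / real n powr ((q - 2) / 2)" .
  have "real n * (abs_moment q M / (real n powr (q / 2) * cmod Z powr q))
    = abs_moment q M * (real n / real n powr (q / 2)) / cmod Z powr q" by simp
  then show "real n * (abs_moment q M / cmod (of_real (sqrt (real n)) * Z) powr q) = L / cmod Z powr q"
    unfolding c p e lyapunov_fraction_def by simp
  have "real n powr ((2 - q) / 2) = real n powr - ((q - 2) / 2)" by (simp only: minus_divide_left minus_diff_eq)
  also have "\<dots> = 1 / real n powr ((q - 2) / 2)" by (simp add: powr_minus_divide)
  finally show "sqrt (real n) * (abs_moment q M * cmod (of_real (sqrt (real n)) * Z) powr (2 - q)) / sqrt (real n)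
      = L * cmod Z powr (2 - q)"
    unfolding c p lyapunov_fraction_def using n by simp
qed

end

text \<open>The factor 1 - 1 / (Z \<omega>), with \<omega> = exp (i phi), is the divided difference
  of Z + 1 / Z between Z and \<omega>. At Z = \<omega> its modulus is exactly 2 sin phi, and within
  the disc it changes by at most sin phi / 3.\<close>

lemma cis_ball_bounds:
  assumes \<phi>: "sin \<phi> > 0" and Z: "cmod (Z - cis \<phi>) \<le> sin \<phi> / 4"
  shows "3 / 4 \<le> cmod Z" "cmod Z \<le> 5 / 4" "3 / 4 * sin \<phi> \<le> Im Z"
    "cmod (1 - 1 / (Z * cis \<phi>)) \<le> 7 / 3 * sin \<phi>" "sin \<phi> \<le> cmod (1 - 1 / (Z * cis \<phi>))"
proof -
  have s1: "sin \<phi> \<le> 1" by simp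
  show Z1: "3 / 4 \<le> cmod Z" "cmod Z \<le> 5 / 4"
    using norm_triangle_ineq3[of Z "cis \<phi>"] Z s1 unfolding norm_cis by linarith+
  show "3 / 4 * sin \<phi> \<le> Im Z" using abs_Im_le_cmod[of "Z - cis \<phi>"] Z by simp
  have Z0: "Z \<noteq> 0" using Z1 by auto
  have "1 - 1 / (cis \<phi>)\<^sup>2 = (cis \<phi> - inverse (cis \<phi>)) / cis \<phi>"
    by (simp add: field_simps power2_eq_square)
  also have "cis \<phi> - inverse (cis \<phi>) = 2 * \<i> * of_real (sin \<phi>)" by (simp add: complex_eq_iff)
  finally have d: "cmod (1 - 1 / (cis \<phi>)\<^sup>2) = 2 * sin \<phi>" using \<phi> by (simp add: norm_divide norm_mult)
  have "1 / (cis \<phi>)\<^sup>2 - 1 / (Z * cis \<phi>) = (Z - cis \<phi>) / (Z * (cis \<phi>)\<^sup>2)"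
    using Z0 by (simp add: field_simps power2_eq_square)
  then have "cmod (1 / (cis \<phi>)\<^sup>2 - 1 / (Z * cis \<phi>)) = cmod (Z - cis \<phi>) / cmod Z"
    by (simp add: norm_divide norm_mult norm_power)
  also have "\<dots> \<le> (sin \<phi> / 4) / (3 / 4)" using Z Z1 \<phi> by (intro frac_le) auto
  finally have d2: "cmod (1 / (cis \<phi>)\<^sup>2 - 1 / (Z * cis \<phi>)) \<le> sin \<phi> / 3" by simp
  have eq: "1 - 1 / (Z * cis \<phi>) = (1 - 1 / (cis \<phi>)\<^sup>2) + (1 / (cis \<phi>)\<^sup>2 - 1 / (Z * cis \<phi>))" by simp
  show "cmod (1 - 1 / (Z * cis \<phi>)) \<le> 7 / 3 * sin \<phi>"
    using norm_triangle_ineq[of "1 - 1 / (cis \<phi>)\<^sup>2" "1 / (cis \<phi>)\<^sup>2 - 1 / (Z * cis \<phi>)"] d d2 unfolding eq[symmetric] by linarith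
  show "sin \<phi> \<le> cmod (1 - 1 / (Z * cis \<phi>))"
    using norm_diff_ineq[of "1 - 1 / (cis \<phi>)\<^sup>2" "1 / (cis \<phi>)\<^sup>2 - 1 / (Z * cis \<phi>)"] d d2 \<phi> unfolding eq[symmetric] by linarith
qed

lemma one_divide_two_square: "1 / (2 * w\<^sup>2) = inverse w * inverse w / 2" for w :: complex
  by (cases "w = 0") (simp_all add: field_simps power2_eq_square)

lemma Im_divide_cis: "Im (of_real (2 * cos \<phi>) / (cis \<phi>)) = - 2 * (sin \<phi> * cos \<phi>)"
  unfolding divide_inverse cis_inverse by simp

lemma Im_divide_cis_square: "Im (1 / (2 * (cis \<phi>)\<^sup>2)) = - (sin \<phi> * cos \<phi>)"
  unfolding one_divide_two_square cis_inverse by simp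

text \<open>By \<open>semicircle_cdf_cos\<close> the value is pi times the upper semicircle tail at
  2 cos phi.\<close>

lemma semicircle_potential_cis:
  assumes "0 < \<phi>" "\<phi> < pi"
  shows "Im (Ln (cis \<phi>) - 1 / (2 * (cis \<phi>)\<^sup>2) + of_real (2 * cos \<phi>) / cis \<phi>) = \<phi> - sin \<phi> * cos \<phi>"
proof -
  have "- pi < Im (\<i> * of_real \<phi>)" "Im (\<i> * of_real \<phi>) \<le> pi" using assms by simp_all
  then have Ln_cis_eq: "Ln (cis \<phi>) = \<i> * of_real \<phi>" unfolding cis_conv_exp by (rule Ln_exp)
  have 1: "Im (Ln (cis \<phi>)) = \<phi>" unfolding Ln_cis_eq by simp
  have "Im (a - b + c) = Im a - Im b + Im c" for a b c by simp
  from this[of "Ln (cis \<phi>)" "1 / (2 * (cis \<phi>)\<^sup>2)" "of_real (2 * cos \<phi>) / cis \<phi>"]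
  show ?thesis using 1 Im_divide_cis_square[of \<phi>] Im_divide_cis[of \<phi>] by linarith
qed

text \<open>\<open>cis \<phi>\<close> is a critical point of this function, so an error in \<open>Z\<close> enters quadratically.\<close>

lemma semicircle_potential_stationary:
  assumes \<phi>: "0 < \<phi>" "\<phi> < pi" and Z: "cmod (Z - cis \<phi>) \<le> sin \<phi> / 4"
  shows "\<bar>Im (Ln Z - 1 / (2 * Z\<^sup>2) + of_real (2 * cos \<phi>) / Z) - (\<phi> - sin \<phi> * cos \<phi>)\<bar> \<le> 5 * sin \<phi> * (cmod (Z - cis \<phi>))\<^sup>2"
proof -
  have s: "sin \<phi> > 0" using \<phi> by (rule sin_gt_zero)
  let ?\<omega> = "cis \<phi>"
  let ?r = "cmod (Z - ?\<omega>)"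
  let ?P = "\<lambda>Y::complex. Ln Y - 1 / (2 * Y\<^sup>2) + of_real (2 * cos \<phi>) / Y"
  have "cmod (?P Z - ?P ?\<omega>) \<le> (?r * (7 / 3 * sin \<phi>) / (3 / 4)\<^sup>2) * cmod (Z - ?\<omega>)"
  \<comment> \<open>The derivative is (Y + 1 / Y - 2 cos phi) / Y^2, and its numerator factors
    because 2 cos phi = \<omega> + 1 / \<omega>. The factor Y - \<omega> exhibits the critical
    point.\<close>
  proof (rule field_differentiable_bound[where S = "cball ?\<omega> ?r" and f' = "\<lambda>Y. (Y - ?\<omega>) * (1 - 1 / (Y * ?\<omega>)) / Y\<^sup>2"])
    fix Y assume "Y \<in> cball ?\<omega> ?r"
    then have Yr: "cmod (Y - ?\<omega>) \<le> ?r" by (simp add: dist_norm norm_minus_commute)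
    then have Y: "cmod (Y - ?\<omega>) \<le> sin \<phi> / 4" using Z by linarith
    note b = cis_ball_bounds[OF s Y]
    have Y0: "Y \<noteq> 0" using b(1) by auto
    have ImY: "Im Y > 0" using b(3) s by linarith
    have c: "of_real (2 * cos \<phi>) = ?\<omega> + 1 / ?\<omega>" by (simp add: divide_inverse complex_eq_iff)
    have d1: "(Ln has_field_derivative 1 / Y) (at Y within cball ?\<omega> ?r)"
      using has_field_derivative_Ln[OF Im_pos_not_nonpos_Real[OF ImY]]
      by (simp add: has_field_derivative_at_within divide_inverse)
    have d2: "((\<lambda>Y. 1 / (2 * Y\<^sup>2)) has_field_derivative - (1 / Y ^ 3)) (at Y within cball ?\<omega> ?r)"
      using Y0 by (auto intro!: derivative_eq_intros simp: power2_eq_square power3_eq_cube)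
    have d3: "((\<lambda>Y. of_real (2 * cos \<phi>) / Y) has_field_derivative - (of_real (2 * cos \<phi>) / Y\<^sup>2)) (at Y within cball ?\<omega> ?r)"
      using Y0 by (auto intro!: derivative_eq_intros simp: power2_eq_square)
    have "(?P has_field_derivative (1 / Y - - (1 / Y ^ 3) + - (of_real (2 * cos \<phi>) / Y\<^sup>2))) (at Y within cball ?\<omega> ?r)"
      by (rule DERIV_add[OF DERIV_diff[OF d1 d2] d3])
    also have "1 / Y - - (1 / Y ^ 3) + - (of_real (2 * cos \<phi>) / Y\<^sup>2) = 1 / Y + 1 / Y ^ 3 - of_real (2 * cos \<phi>) / Y\<^sup>2"
      by simp
    also have "1 / Y + 1 / Y ^ 3 - of_real (2 * cos \<phi>) / Y\<^sup>2 = (Y - ?\<omega>) * (1 - 1 / (Y * ?\<omega>)) / Y\<^sup>2"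
    proof -
      have "1 / Y + 1 / Y ^ 3 - (w + 1 / w) / Y\<^sup>2 = (Y - w) * (1 - 1 / (Y * w)) / Y\<^sup>2" if "w \<noteq> 0" for w
        using that Y0 by (simp add: field_simps power2_eq_square power3_eq_cube)
      then show ?thesis unfolding c by simp
    qed
    finally show "(?P has_field_derivative (Y - ?\<omega>) * (1 - 1 / (Y * ?\<omega>)) / Y\<^sup>2) (at Y within cball ?\<omega> ?r)" .
    have "cmod ((Y - ?\<omega>) * (1 - 1 / (Y * ?\<omega>)) / Y\<^sup>2) = cmod (Y - ?\<omega>) * cmod (1 - 1 / (Y * ?\<omega>)) / (cmod Y)\<^sup>2"
      by (simp add: norm_mult norm_divide norm_power)
    also have "\<dots> \<le> ?r * (7 / 3 * sin \<phi>) / (3 / 4)\<^sup>2"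
    proof (rule frac_le)
      show "cmod (Y - ?\<omega>) * cmod (1 - 1 / (Y * ?\<omega>)) \<le> ?r * (7 / 3 * sin \<phi>)"
        by (rule mult_mono[OF Yr b(4)]) auto
      show "(3 / 4)\<^sup>2 \<le> (cmod Y)\<^sup>2" by (rule power_mono[OF b(1)]) simp
    qed (use s in auto)
    finally show "cmod ((Y - ?\<omega>) * (1 - 1 / (Y * ?\<omega>)) / Y\<^sup>2) \<le> ?r * (7 / 3 * sin \<phi>) / (3 / 4)\<^sup>2" .
  qed (auto simp: dist_norm norm_minus_commute)
  also have "\<dots> = 112 / 27 * (sin \<phi> * ?r\<^sup>2)"
  proof -
    have "(r * (7 / 3 * a) / (3 / 4)\<^sup>2) * r = 112 / 27 * (a * r\<^sup>2)" for r a :: real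
      by (simp add: power2_eq_square)
    then show ?thesis .
  qed
  also have "\<dots> \<le> 5 * (sin \<phi> * ?r\<^sup>2)" using s by (intro mult_right_mono) auto
  finally have 1: "cmod (?P Z - ?P ?\<omega>) \<le> 5 * sin \<phi> * ?r\<^sup>2" by (simp only: mult.assoc)
  have "Im (?P Z - ?P ?\<omega>) = Im (?P Z) - Im (?P ?\<omega>)" by (rule minus_complex.sel(2))
  also have "Im (?P ?\<omega>) = \<phi> - sin \<phi> * cos \<phi>" by (rule semicircle_potential_cis[OF \<phi>])
  finally have "\<bar>Im (?P Z) - (\<phi> - sin \<phi> * cos \<phi>)\<bar> = \<bar>Im (?P Z - ?P ?\<omega>)\<bar>" by (rule arg_cong[OF sym])
  also have "\<dots> \<le> cmod (?P Z - ?P ?\<omega>)" by (rule abs_Im_le_cmod)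
  finally show ?thesis using 1 by (rule order_trans)
qed

section \<open>The perturbed semicircle equation and its root near exp (i phi)\<close>

context lyapunov_free_power
begin

text \<open>With \<open>Z = subord (sqrt n z) / sqrt n\<close>, the subordination equation reads
  \<open>Z + 1 / Z + subord_error Z = z\<close>; without the error term it is the equation of the semicircle law.\<close>

definition subord_error :: "complex \<Rightarrow> complex" where
  "subord_error Z = of_real ((real n - 1) / sqrt (real n)) *
     (of_real (sqrt (real n)) * Z - F (of_real (sqrt (real n)) * Z)) - 1 / Z"

lemma norm_scaled_defect_le:
  assumes "Im Z > 0"
  shows "cmod (of_real (sqrt (real n)) * Z - F (of_real (sqrt (real n)) * Z)) \<le> 1 / (sqrt (real n) * Im Z)"
  using norm_defect_le[of "of_real (sqrt (real n)) * Z"] assms n_ge_1 by simp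

text \<open>Since (n - 1) / sqrt n = sqrt n - 1 / sqrt n, the error is sqrt n times the defect
  approximation error, minus E / sqrt n. The moment term contributes 32/9 L / s; everything else is
  of order 1 / n and fits into the gap up to 4.\<close>

lemma subord_error_le:
  assumes s: "s > 0" "50 * L \<le> s ^ 3" "s \<le> 1"
    and Z: "3 / 4 \<le> cmod Z" "3 / 4 * s \<le> Im Z"
  shows "cmod (subord_error Z) \<le> 4 * L / s"
proof -
  let ?r = "sqrt (real n)"
  let ?z = "of_real ?r * Z"
  define E where "E = ?z - F ?z"
  have n: "real n \<ge> 1" using n_ge_1 by simp
  have r: "?r > 0" "?r\<^sup>2 = real n" using n by auto
  have ImZ: "Im Z > 0" using Z s by (smt (verit) mult_pos_pos zero_less_divide_iff)
  have Z0: "Z \<noteq> 0" using ImZ by auto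
  have Imz: "Im ?z = ?r * Im Z" "cmod ?z = ?r * cmod Z" using r by (auto simp: norm_mult)
  have "s ^ 3 \<le> s ^ 1" using s by (intro power_decreasing) auto
  then have Ls: "50 * L \<le> s" using s by simp
  have L0: "L > 0" by (rule L_pos)
  \<comment> \<open>The spare factor s gained here pays for the higher negative powers of s that
    accompany 1 / n.\<close>
  have q1: "L\<^sup>2 \<le> L * (s / 50)" unfolding power2_eq_square using Ls L0 by (intro mult_left_mono) auto
  have eq: "subord_error Z = of_real ?r * (E - 1 / ?z) - of_real (1 / ?r) * E"
  proof -
    have "(real n - 1) / ?r = ?r - 1 / ?r" using r by (simp add: field_simps power2_eq_square)
    then have "subord_error Z = (of_real ?r - of_real (1 / ?r)) * E - 1 / Z"
      unfolding subord_error_def E_def by simp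
    also have "1 / Z = of_real ?r * (1 / ?z)" using r by simp
    finally show ?thesis by (simp only: algebra_simps)
  qed
  have "cmod (of_real ?r * (E - 1 / ?z)) \<le>
     ?r * (2 * abs_moment q M * cmod ?z powr (2 - q) / Im ?z + 1 / ((Im ?z)\<^sup>2 * cmod ?z))"
    unfolding norm_mult norm_of_real E_def
    using recip_cauchy_transform_defect_approx[of ?z, OF _ q integrable_powr] Imz r ImZ by (simp add: mult_left_mono)
  also have "\<dots> = 2 * (?r * (abs_moment q M * cmod ?z powr (2 - q)) / ?r) / Im Z + 1 / (real n * ((Im Z)\<^sup>2 * cmod Z))"
  proof -
    have "?r * (1 / ((?r * Im Z)\<^sup>2 * (?r * cmod Z))) = 1 / (?r\<^sup>2 * ((Im Z)\<^sup>2 * cmod Z))"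
      using r by (simp add: power2_eq_square)
    moreover have "?r * (2 * a / (?r * Im Z)) = 2 * (?r * a / ?r) / Im Z" for a using r by simp
    ultimately show ?thesis unfolding Imz r(2) distrib_left mult.assoc by simp
  qed
  also have "\<dots> = 2 * (L * cmod Z powr (2 - q)) / Im Z + (1 / real n) * (1 / ((Im Z)\<^sup>2 * cmod Z))"
    unfolding scaled_moment(2)[OF Z0] by simp
  also have "\<dots> \<le> 2 * (L * (4 / 3)) / (3 / 4 * s) + L\<^sup>2 * (1 / ((3 / 4 * s)\<^sup>2 * (3 / 4)))"
  proof (intro add_mono frac_le mult_mono inverse_n_le_L_square power_mono)
    have "cmod Z powr (2 - q) \<le> (3 / 4) powr (2 - q)" using Z q by (intro powr_mono2') auto
    also have "\<dots> \<le> (3 / 4) powr (- 1)" using q by (intro powr_mono') auto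
    also have "(3 / 4 :: real) powr (- 1) = 4 / 3" by (simp add: powr_minus_divide)
    finally show "cmod Z powr (2 - q) \<le> 4 / 3" .
  qed (use Z s L0 in auto)
  also have "\<dots> \<le> 2 * (L * (4 / 3)) / (3 / 4 * s) + L * (s / 50) * (1 / ((3 / 4 * s)\<^sup>2 * (3 / 4)))"
    using q1 s by (intro add_left_mono mult_right_mono) auto
  also have "\<dots> = (32 / 9 + 32 / 675) * (L / s)" using s by (simp add: power2_eq_square field_simps)
  finally have 1: "cmod (of_real ?r * (E - 1 / ?z)) \<le> (32 / 9 + 32 / 675) * (L / s)" .
  have "cmod (of_real (1 / ?r) * E) \<le> 1 / ?r * (1 / (?r * Im Z))"
    unfolding norm_mult norm_of_real E_def using norm_scaled_defect_le[OF ImZ] r by (intro mult_mono) auto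
  also have "\<dots> = (1 / real n) * (1 / Im Z)" using r by (simp add: power2_eq_square[symmetric])
  also have "\<dots> \<le> (L * (s / 50)) * (1 / (3 / 4 * s))"
    using inverse_n_le_L_square q1 Z s L0 by (intro mult_mono frac_le) auto
  also have "\<dots> = 2 / 75 * s * (L / s)" using s by (simp add: field_simps)
  also have "\<dots> \<le> 2 / 75 * 1 * (L / s)" using s L0 by (intro mult_right_mono mult_left_mono) auto
  finally have 2: "cmod (of_real (1 / ?r) * E) \<le> 2 / 75 * (L / s)" by simp
  have Ls0: "L / s \<ge> 0" using L0 s by simp
  have "cmod (subord_error Z) \<le> (32 / 9 + 32 / 675) * (L / s) + 2 / 75 * (L / s)"
    unfolding eq using norm_triangle_ineq4[of "of_real ?r * (E - 1 / ?z)" "of_real (1 / ?r) * E"] 1 2 by linarith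
  also have "\<dots> = (32 / 9 + 32 / 675 + 2 / 75) * (L / s)" by (simp only: distrib_right)
  also have "\<dots> \<le> 4 * (L / s)" using Ls0 by (intro mult_right_mono) auto
  finally show ?thesis by simp
qed

text \<open>In the form (Z - \<omega>) (1 - 1 / (Z \<omega>)) = i v - \<open>subord_error Z\<close>
  the equation becomes a fixed point problem after division by the second factor, which has modulus
  at least s. Brouwer's theorem asks only for continuity of the error, no derivative bound;
  uniqueness comes from \<open>subord_unique\<close>.\<close>

lemma subord_near_cis:
  assumes \<phi>: "0 < \<phi>" "\<phi> < pi" and L: "50 * L \<le> sin \<phi> ^ 3" and v: "0 < v" "v \<le> L"
  obtains Z where "cmod (Z - cis \<phi>) \<le> 5 * L / (sin \<phi>)\<^sup>2" "cmod (Z - cis \<phi>) \<le> sin \<phi> / 4"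
    "subord (of_real (sqrt (real n)) * Complex (2 * cos \<phi>) v) = of_real (sqrt (real n)) * Z"
proof -
  let ?\<omega> = "cis \<phi>"
  let ?r = "sqrt (real n)"
  define s where "s = sin \<phi>"
  have s: "s > 0" "s \<le> 1" using \<phi> by (auto simp: s_def sin_gt_zero)
  have Ls: "50 * L \<le> s ^ 3" using L by (simp add: s_def)
  have L0: "L > 0" by (rule L_pos)
  have n: "real n \<ge> 1" using n_ge_1 by simp
  have r: "?r > 0" "?r\<^sup>2 = real n" using n by auto
  define T where "T Z = ?\<omega> + (\<i> * of_real v - subord_error Z) / (1 - 1 / (Z * ?\<omega>))" for Z
  note ball = cis_ball_bounds[of \<phi>, folded s_def, OF s(1)]
  have b: "cmod (Z - ?\<omega>) \<le> s / 4" if "Z \<in> cball ?\<omega> (s / 4)" for Z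
    using that by (simp add: dist_norm norm_minus_commute)
  have L_s: "L \<le> L / s" using s L0 by (simp add: le_divide_eq mult_left_le)
  have T_le: "cmod (T Z - ?\<omega>) \<le> 5 * L / s\<^sup>2" if "Z \<in> cball ?\<omega> (s / 4)" for Z
  proof -
    note bb = ball[OF b[OF that]]
    have "cmod (\<i> * of_real v - subord_error Z) \<le> v + 4 * L / s"
      using norm_triangle_ineq4[of "\<i> * of_real v" "subord_error Z"] subord_error_le[OF s(1) Ls s(2) bb(1,3)] v
      by (simp add: norm_mult)
    also have "\<dots> \<le> 5 * L / s" using v L_s by (simp add: add_divide_distrib[symmetric])
    finally have "cmod (\<i> * of_real v - subord_error Z) / cmod (1 - 1 / (Z * ?\<omega>)) \<le> (5 * L / s) / s"
      using bb(5) s L0 by (intro frac_le) auto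
    then show ?thesis by (simp add: T_def norm_divide power2_eq_square)
  qed
  \<comment> \<open>The self-mapping condition, equivalent to 20 L \<le> s^3.\<close>
  have small: "5 * L / s\<^sup>2 \<le> s / 4"
  proof -
    have "5 * L \<le> s / 4 * s\<^sup>2" using Ls s L0 by (simp add: power2_eq_square power3_eq_cube)
    then show ?thesis using s by (simp add: pos_divide_le_eq)
  qed
  have cont: "continuous_on (cball ?\<omega> (s / 4)) T"
  proof -
    have F: "continuous_on {z. Im z > 0} F"
      by (rule holomorphic_on_imp_continuous_on[OF holomorphic_recip_cauchy_transform])
    have pos: "Im Z > 0" if "Z \<in> cball ?\<omega> (s / 4)" for Z
      using ball(3)[OF b[OF that]] s by (smt (verit) mult_pos_pos zero_less_divide_iff)
    have "continuous_on (cball ?\<omega> (s / 4)) (\<lambda>Z. F (of_real ?r * Z))"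
      by (rule continuous_on_compose2[OF F]) (use r pos n_ge_1 in \<open>auto intro!: continuous_intros\<close>)
    moreover have "Z \<noteq> 0" if "Z \<in> cball ?\<omega> (s / 4)" for Z using pos[OF that] by auto
    moreover have "1 - 1 / (Z * ?\<omega>) \<noteq> 0" if "Z \<in> cball ?\<omega> (s / 4)" for Z
      using ball(5)[OF b[OF that]] s by (metis norm_zero not_less)
    ultimately show ?thesis unfolding T_def subord_error_def
      by (intro continuous_intros ballI) (auto simp del: mem_cball)
  qed
  obtain Z where Zb: "Z \<in> cball ?\<omega> (s / 4)" and TZ: "T Z = Z"
  proof (rule brouwer_ball[of "s / 4" ?\<omega> T])
    show "T \<in> cball ?\<omega> (s / 4) \<rightarrow> cball ?\<omega> (s / 4)"
    proof
      fix Z assume "Z \<in> cball ?\<omega> (s / 4)"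
      from order_trans[OF T_le[OF this] small] show "T Z \<in> cball ?\<omega> (s / 4)"
        by (simp add: dist_norm norm_minus_commute)
    qed
  qed (use s cont in auto)
  note bb = ball[OF b[OF Zb]]
  have Z0: "Z \<noteq> 0" using bb(1) by auto
  have ImZ: "Im Z > 0" using bb(3) s by (smt (verit) mult_pos_pos zero_less_divide_iff)
  have nz: "1 - 1 / (Z * ?\<omega>) \<noteq> 0" using bb(5) s by (metis norm_zero not_less)
  have "(Z - ?\<omega>) * (1 - 1 / (Z * ?\<omega>)) = \<i> * of_real v - subord_error Z"
  proof (rule nonzero_eq_divide_eq[OF nz, THEN iffD1])
    show "Z - ?\<omega> = (\<i> * of_real v - subord_error Z) / (1 - 1 / (Z * ?\<omega>))"
      using TZ unfolding T_def by (metis add_diff_cancel_left')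
  qed
  moreover have "(Z - ?\<omega>) * (1 - 1 / (Z * ?\<omega>)) = Z + 1 / Z - (?\<omega> + 1 / ?\<omega>)"
    using Z0 by (simp add: field_simps)
  moreover have "?\<omega> + 1 / ?\<omega> = of_real (2 * cos \<phi>)" by (simp add: complex_eq_iff Re_divide Im_divide)
  ultimately have "Z + (subord_error Z + 1 / Z) = Complex (2 * cos \<phi>) v"
    by (simp add: Complex_eq algebra_simps)
  then have "of_real ?r * (Z + (subord_error Z + 1 / Z)) = of_real ?r * Complex (2 * cos \<phi>) v" by simp
  also have "of_real ?r * (Z + (subord_error Z + 1 / Z)) = of_real ?r * Z + (of_nat n - 1) * (of_real ?r * Z - F (of_real ?r * Z))"
    using r unfolding subord_error_def by (simp add: distrib_left)
  finally have "of_nat n * (of_real ?r * Z) - (of_nat n - 1) * F (of_real ?r * Z) = of_real ?r * Complex (2 * cos \<phi>) v"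
    by (simp add: algebra_simps)
  then have "subord (of_real ?r * Complex (2 * cos \<phi>) v) = of_real ?r * Z"
    using r v ImZ by (intro subord_unique) auto
  then show thesis using that[of Z] T_le[OF Zb] b[OF Zb] TZ by (simp add: s_def)
qed

text \<open>Expanding both terms of \<open>mean_arg_subord\<close> at \<zeta> = sqrt n Z, the
  multiples n and n - 1 of Arg \<zeta> leave a single Arg Z, and the second-order terms complete it
  to the semicircle potential. The error budget is 95 + 1 + 4/3 + 5/2 < 100.\<close>

lemma mean_arg_semicircle_approx:
  assumes \<phi>: "0 < \<phi>" "\<phi> < pi" and L: "50 * L \<le> sin \<phi> ^ 3" and v: "0 < v" "v \<le> L"
  shows "\<bar>N.mean_arg (of_real (sqrt (real n)) * Complex (2 * cos \<phi>) v) - (\<phi> - sin \<phi> * cos \<phi>)\<bar> \<le> 100 * L"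
proof -
  let ?r = "sqrt (real n)"
  let ?x = "2 * cos \<phi>"
  define s where "s = sin \<phi>"
  have s: "s > 0" "s \<le> 1" using \<phi> by (auto simp: s_def sin_gt_zero)
  have Ls: "50 * L \<le> s ^ 3" using L by (simp add: s_def)
  have L0: "L > 0" by (rule L_pos)
  have n: "real n \<ge> 1" using n_ge_1 by simp
  have r: "?r > 0" "?r\<^sup>2 = real n" using n by auto
  obtain Z where Z: "cmod (Z - cis \<phi>) \<le> 5 * L / s\<^sup>2" "cmod (Z - cis \<phi>) \<le> s / 4"
    and sub: "subord (of_real ?r * Complex ?x v) = of_real ?r * Z"
    using subord_near_cis[OF assms] unfolding s_def by blast
  define z where "z = of_real ?r * Complex ?x v"
  define \<zeta> where "\<zeta> = of_real ?r * Z"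
  define E where "E = \<zeta> - F \<zeta>"
  note bb = cis_ball_bounds[of \<phi>, folded s_def, OF s(1) Z(2)]
  have Z0: "Z \<noteq> 0" using bb(1) by auto
  have ImZ: "Im Z > 0" using bb(3) s by (smt (verit) mult_pos_pos zero_less_divide_iff)
  have Imz: "Im z > 0" using v r by (simp add: z_def)
  have \<zeta>: "Im \<zeta> > 0" "\<zeta> \<noteq> 0" "cmod \<zeta> = ?r * cmod Z" using ImZ Z0 r by (auto simp: \<zeta>_def norm_mult)
  have Fz: "recip_cauchy_transform N z = \<zeta> - E" using F_subord[OF Imz] sub by (simp add: z_def \<zeta>_def E_def)
  \<comment> \<open>Makes the linear term of the logarithm explicit: (n - 1) E / \<zeta> is z /
    \<zeta> - 1, which yields 2 cos phi / Z up to O(v) and a real constant.\<close>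
  have nE: "(of_nat n - 1) * E = z - \<zeta>"
    using subord_equation[OF Imz] sub unfolding z_def[symmetric] \<zeta>_def[symmetric] E_def by (simp add: algebra_simps)
  have "s ^ 3 \<le> s\<^sup>2" "s ^ 3 \<le> s ^ 1" using s by (intro power_decreasing; simp)+
  then have s23: "50 * L \<le> s\<^sup>2" "50 * L \<le> s" using Ls by auto
  have t: "cmod (E / \<zeta>) \<le> 16 / 9 * (1 / real n) / s"
  proof -
    have "cmod (E / \<zeta>) \<le> (1 / (?r * Im Z)) / (?r * cmod Z)"
      unfolding norm_divide \<zeta>(3) using norm_scaled_defect_le[OF ImZ] r Z0
      by (intro divide_right_mono) (auto simp: E_def \<zeta>_def)
    also have "\<dots> = (1 / real n) * (1 / (Im Z * cmod Z))" using r by (simp add: power2_eq_square[symmetric] field_simps)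
    also have "\<dots> \<le> (1 / real n) * (1 / ((3 / 4 * s) * (3 / 4)))"
      using bb(1,3) s by (intro mult_left_mono frac_le mult_mono) auto
    finally show ?thesis by simp
  qed
  have t': "cmod (E / \<zeta>) \<le> 16 / 9 * (L * (1 / 50))"
  proof -
    have "16 / 9 * (1 / real n) / s \<le> 16 / 9 * L\<^sup>2 / s"
      using inverse_n_le_L_square s by (intro divide_right_mono mult_left_mono) auto
    also have "\<dots> = 16 / 9 * (L * (L / s))" by (simp add: power2_eq_square)
    also have "\<dots> \<le> 16 / 9 * (L * (1 / 50))" using s23 s L0 by (intro mult_left_mono) (auto simp: divide_le_eq)
    finally show ?thesis using t by linarith
  qed
  have L1: "L \<le> 1 / 50" using s23 s by linarith
  have t2: "cmod (E / \<zeta>) \<le> 1 / 2" using t' L1 by linarith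
  have LnF: "\<bar>(real n - 1) * Im (Ln (recip_cauchy_transform N z)) - (real n - 1) * Im (Ln \<zeta>) + Im ((of_nat n - 1) * E / \<zeta>)\<bar> \<le> L"
  proof -
    have "1 + - (E / \<zeta>) = (\<zeta> - E) / \<zeta>" using \<zeta> by (simp add: field_simps)
    then have "Ln (1 + - (E / \<zeta>)) = Ln (\<zeta> - E) - Ln \<zeta>"
      using Ln_divide_upper[OF \<zeta>(1), of "\<zeta> - E"] N.Im_recip_cauchy_transform_ge[OF Imz] Imz unfolding Fz by simp
    then have "\<bar>Im (Ln (\<zeta> - E)) - Im (Ln \<zeta>) + Im (E / \<zeta>)\<bar> = \<bar>Im (Ln (1 + - (E / \<zeta>)) - - (E / \<zeta>))\<bar>"
      by simp
    also have "\<dots> \<le> cmod (Ln (1 + - (E / \<zeta>)) - - (E / \<zeta>))" by (rule abs_Im_le_cmod)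
    also have "\<dots> \<le> 2 * (cmod (E / \<zeta>))\<^sup>2"
      using norm_Ln_one_plus_diff_le[of "- (E / \<zeta>)"] t2 by simp
    finally have 1: "\<bar>Im (Ln (\<zeta> - E)) - Im (Ln \<zeta>) + Im (E / \<zeta>)\<bar> \<le> 2 * (cmod (E / \<zeta>))\<^sup>2" .
    have "Im ((of_nat n - 1) * E / \<zeta>) = (real n - 1) * Im (E / \<zeta>)"
    proof -
      have "(of_nat n - 1) * E / \<zeta> = of_real (real n - 1) * (E / \<zeta>)" by simp
      then show ?thesis by (metis Im_complex_of_real Re_complex_of_real mult_zero_left add.right_neutral times_complex.sel(2))
    qed
    then have "\<bar>(real n - 1) * Im (Ln (recip_cauchy_transform N z)) - (real n - 1) * Im (Ln \<zeta>) + Im ((of_nat n - 1) * E / \<zeta>)\<bar>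
        = \<bar>(real n - 1) * (Im (Ln (\<zeta> - E)) - Im (Ln \<zeta>) + Im (E / \<zeta>))\<bar>"
      unfolding Fz by (simp only: right_diff_distrib distrib_left)
    also have "\<dots> \<le> real n * (2 * (cmod (E / \<zeta>))\<^sup>2)"
      unfolding abs_mult using 1 n by (intro mult_mono) auto
    also have "\<dots> \<le> real n * (2 * (16 / 9 * (1 / real n) / s)\<^sup>2)"
      using t n by (intro mult_left_mono power_mono) auto
    also have "\<dots> = 512 / 81 * ((1 / real n) / s\<^sup>2)" using n by (simp add: power2_eq_square)
    also have "\<dots> \<le> 512 / 81 * (L\<^sup>2 / s\<^sup>2)"
      using inverse_n_le_L_square s by (intro divide_right_mono mult_left_mono) auto
    also have "L\<^sup>2 / s\<^sup>2 = L * (L / s\<^sup>2)" by (simp add: power2_eq_square)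
    also have "512 / 81 * (L * (L / s\<^sup>2)) \<le> 512 / 81 * (L * (1 / 50))"
      using s23 s L0 by (intro mult_left_mono) (auto simp: divide_le_eq)
    also have "\<dots> \<le> L" using L0 by simp
    finally show ?thesis by simp
  qed
  have A: "\<bar>real n * mean_arg \<zeta> - real n * Im (Ln \<zeta>) + Im (1 / (2 * Z\<^sup>2))\<bar> \<le> 95 * L"
  proof -
    have "\<zeta>\<^sup>2 = of_real (real n) * Z\<^sup>2"
      unfolding \<zeta>_def power_mult_distrib of_real_power[symmetric] r(2) ..
    then have "of_real (real n) * (1 / (2 * \<zeta>\<^sup>2)) = 1 / (2 * Z\<^sup>2)" using n by simp
    moreover have "Im (of_real a * w) = a * Im w" for a w by simp
    ultimately have im: "real n * Im (1 / (2 * \<zeta>\<^sup>2)) = Im (1 / (2 * Z\<^sup>2))" by metis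
    have "\<bar>real n * mean_arg \<zeta> - real n * Im (Ln \<zeta>) + real n * Im (1 / (2 * \<zeta>\<^sup>2))\<bar>
        = real n * \<bar>mean_arg \<zeta> - Im (Ln \<zeta>) + Im (1 / (2 * \<zeta>\<^sup>2))\<bar>"
      using n by (simp only: right_diff_distrib[symmetric] distrib_left[symmetric] abs_mult)
    also have "\<dots> \<le> real n * (40 * abs_moment q M / cmod \<zeta> powr q)"
      by (intro mult_left_mono mean_arg_expansion \<zeta> q integrable_powr) simp
    also have "\<dots> = 40 * (real n * (abs_moment q M / cmod \<zeta> powr q))" by simp
    also have "\<dots> = 40 * (L / cmod Z powr q)"
      unfolding \<zeta>_def scaled_moment(1)[OF Z0] ..
    \<comment> \<open>From |Z| \<ge> 3/4 and q \<le> 3; the constant 40 * 64/27 is just below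
      95.\<close>
    also have "\<dots> \<le> 40 * (L / (27 / 64))"
    proof -
      have "27 / 64 = (3 / 4 :: real) powr 3" by (simp add: power3_eq_cube)
      also have "\<dots> \<le> (3 / 4) powr q" using q by (intro powr_mono') auto
      also have "\<dots> \<le> cmod Z powr q" using bb(1) q by (intro powr_mono2) auto
      finally show ?thesis using L0 by (intro mult_left_mono divide_left_mono) auto
    qed
    also have "\<dots> \<le> 95 * L" using L0 by simp
    finally show ?thesis unfolding im .
  qed
  have "(of_nat n - 1) * E / \<zeta> = of_real ?x / Z + \<i> * of_real v / Z - 1"
  proof -
    have "(of_nat n - 1) * E / \<zeta> = z / \<zeta> - 1" unfolding nE using \<zeta> by (simp add: diff_divide_distrib)
    also have "z / \<zeta> = Complex ?x v / Z" using r by (simp add: z_def \<zeta>_def)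
    also have "\<dots> = of_real ?x / Z + \<i> * of_real v / Z" by (simp add: Complex_eq add_divide_distrib)
    finally show ?thesis .
  qed
  then have B: "Im ((of_nat n - 1) * E / \<zeta>) = Im (of_real ?x / Z) + Im (\<i> * of_real v / Z)"
    by (simp only: plus_complex.sel minus_complex.sel one_complex.sel)
  have C: "\<bar>Im (\<i> * of_real v / Z)\<bar> \<le> 4 / 3 * L"
  proof -
    have "\<bar>Im (\<i> * of_real v / Z)\<bar> \<le> cmod (\<i> * of_real v / Z)" by (rule abs_Im_le_cmod)
    also have "\<dots> = v / cmod Z" using v by (simp add: norm_divide norm_mult)
    also have "\<dots> \<le> L / (3 / 4)" using v bb(1) by (intro frac_le) auto
    finally show ?thesis by simp
  qed
  have D: "\<bar>Im (Ln Z - 1 / (2 * Z\<^sup>2) + of_real ?x / Z) - (\<phi> - sin \<phi> * cos \<phi>)\<bar> \<le> 5 / 2 * L"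
  proof -
    have "\<bar>Im (Ln Z - 1 / (2 * Z\<^sup>2) + of_real ?x / Z) - (\<phi> - sin \<phi> * cos \<phi>)\<bar> \<le> 5 * s * (cmod (Z - cis \<phi>))\<^sup>2"
      using semicircle_potential_stationary[OF \<phi>] Z(2) by (simp add: s_def)
    \<comment> \<open>The square of the displacement gives 125 L^2 / s^3, and
      \<open>50 * L \<le> s ^ 3\<close> makes it linear in L.\<close>
    also have "\<dots> \<le> 5 * s * (5 * L / s\<^sup>2)\<^sup>2" using Z(1) s by (intro mult_left_mono power_mono) auto
    also have "\<dots> = 125 * (L * (L / s ^ 3))" using s by (simp add: power2_eq_square power3_eq_cube)
    also have "\<dots> \<le> 125 * (L * (1 / 50))" using Ls s L0 by (intro mult_left_mono) (auto simp: divide_le_eq)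
    finally show ?thesis by simp
  qed
  have Ln\<zeta>: "Im (Ln \<zeta>) = Im (Ln Z)"
    unfolding \<zeta>_def using Ln_times_of_real[OF r(1) Z0] Ln_of_real[OF r(1)] by simp
  have N: "N.mean_arg z = real n * mean_arg \<zeta> - (real n - 1) * Im (Ln (recip_cauchy_transform N z))"
    using mean_arg_subord[OF Imz] sub by (simp add: z_def \<zeta>_def)
  have D': "\<bar>Im (Ln \<zeta>) - Im (1 / (2 * Z\<^sup>2)) + Im (of_real ?x / Z) - (\<phi> - sin \<phi> * cos \<phi>)\<bar> \<le> 5 / 2 * L"
    using D unfolding Ln\<zeta> by simp
  have "(real n - 1) * Im (Ln \<zeta>) = real n * Im (Ln \<zeta>) - Im (Ln \<zeta>)" by (simp add: left_diff_distrib)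
  then have "\<bar>N.mean_arg z - (\<phi> - sin \<phi> * cos \<phi>)\<bar> \<le> 95 * L + L + 4 / 3 * L + 5 / 2 * L"
    using A LnF[unfolded B] C D' unfolding N by linarith
  then show ?thesis using L0 by (simp add: z_def)
qed

end

section \<open>From boundary arguments to distribution functions\<close>

context lyapunov_free_power
begin

text \<open>The argument estimate is uniform for heights in (0, L], so it survives the limit at the
  real line. Division by pi > 3 turns 100 into 34. Closed and open half-lines differ because atoms
  are not excluded.\<close>

lemma cdf_semicircle_approx:
  assumes \<phi>: "0 < \<phi>" "\<phi> < pi" and L: "50 * L \<le> sin \<phi> ^ 3"
  shows "semicircle_cdf (2 * cos \<phi>) - 34 * L \<le> N.prob {..sqrt (real n) * (2 * cos \<phi>)}"
    and "N.prob {..<sqrt (real n) * (2 * cos \<phi>)} \<le> semicircle_cdf (2 * cos \<phi>) + 34 * L"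
proof -
  let ?r = "sqrt (real n)"
  let ?x = "2 * cos \<phi>"
  let ?v = "\<lambda>k. L / real (Suc k)"
  define d where "d = \<phi> - sin \<phi> * cos \<phi>"
  have r: "?r > 0" using n_ge_1 by simp
  have v: "0 < ?v k" "?v k \<le> L" for k
    using L_pos by (auto simp: divide_le_eq mult_le_cancel_left1)
  have lim_v: "(\<lambda>k. ?r * ?v k) \<longlonglongrightarrow> 0"
    using tendsto_mult[OF tendsto_const LIMSEQ_Suc[OF lim_const_over_n[of L]], of ?r] by simp
  obtain l where l: "(\<lambda>k. N.mean_arg (Complex (?r * ?x) (?r * ?v k))) \<longlonglongrightarrow> l"
      "pi * (1 - N.prob {..?r * ?x}) \<le> l" "l \<le> pi * (1 - N.prob {..<?r * ?x})"
    by (rule N.mean_arg_boundary[OF lim_v mult_pos_pos[OF r v(1)]])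
  have "\<bar>N.mean_arg (Complex (?r * ?x) (?r * ?v k)) - d\<bar> \<le> 100 * L" for k
  proof -
    have "Complex (?r * ?x) (?r * ?v k) = of_real ?r * Complex ?x (?v k)" by (simp add: complex_eq_iff)
    then show ?thesis using mean_arg_semicircle_approx[OF \<phi> L v] by (simp add: d_def)
  qed
  then have ld: "\<bar>l - d\<bar> \<le> 100 * L"
    by (intro LIMSEQ_le_const2[OF tendsto_rabs[OF tendsto_diff[OF l(1) tendsto_const]]]) auto
  have w: "pi * (1 - semicircle_cdf ?x) = d"
    using semicircle_cdf_cos[of \<phi>] \<phi> by (simp add: d_def)
  have pi: "100 * L \<le> pi * (34 * L)" using mult_right_mono[of 3 pi "34 * L"] pi_gt3 L_pos by simp
  have "pi * (semicircle_cdf ?x - N.prob {..?r * ?x}) \<le> pi * (34 * L)"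
    using l(2) ld w pi by (simp add: right_diff_distrib)
  then show "semicircle_cdf ?x - 34 * L \<le> N.prob {..?r * ?x}" by simp
  have "pi * (N.prob {..<?r * ?x} - semicircle_cdf ?x) \<le> pi * (34 * L)"
    using l(3) ld w pi by (simp add: right_diff_distrib)
  then show "N.prob {..<?r * ?x} \<le> semicircle_cdf ?x + 34 * L" by simp
qed

text \<open>Quantiles of the semicircle law at distance at least \<open>50 L\<close> from \<open>0\<close> and \<open>1\<close> stay away from the
  edges, where the density degenerates.\<close>

lemma semicircle_quantile:
  assumes "50 * L \<le> \<tau>" "\<tau> \<le> 1 - 50 * L"
  obtains \<phi> where "0 < \<phi>" "\<phi> < pi" "50 * L \<le> sin \<phi> ^ 3" "semicircle_cdf (2 * cos \<phi>) = \<tau>"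
proof -
  \<comment> \<open>The upper semicircle tail as a function of the angle; it runs from 0 at 0 to 1
    at pi, so the intermediate value theorem applies.\<close>
  let ?g = "\<lambda>\<phi>. (\<phi> - sin \<phi> * cos \<phi>) / pi"
  have "\<exists>\<phi>. 0 \<le> \<phi> \<and> \<phi> \<le> pi \<and> ?g \<phi> = 1 - \<tau>"
    by (rule IVT') (use assms L_pos in \<open>auto intro!: continuous_intros\<close>)
  then obtain \<phi> where \<phi>: "0 \<le> \<phi>" "\<phi> \<le> pi" "?g \<phi> = 1 - \<tau>" by blast
  have cdf: "semicircle_cdf (2 * cos \<phi>) = \<tau>" using semicircle_cdf_cos[OF \<phi>(1,2)] \<phi>(3) by simp
  have g: "\<phi> - sin \<phi> * cos \<phi> = pi * (1 - \<tau>)" using \<phi>(3) by (simp add: field_simps)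
  \<comment> \<open>Here pi > 3 cancels the factor 3 of
    \<open>angle_defect_le_sin_cubed\<close>.\<close>
  have pi: "3 * (50 * L) \<le> pi * (50 * L)" using mult_right_mono[of 3 pi "50 * L"] pi_gt3 L_pos by simp
  have s: "50 * L \<le> sin \<phi> ^ 3"
  proof (cases "\<phi> \<le> pi / 2")
    case True
    have "pi * (50 * L) \<le> pi * (1 - \<tau>)" using assms by (intro mult_left_mono) auto
    then show ?thesis using angle_defect_le_sin_cubed[OF \<phi>(1) True] g pi by linarith
  next
    case False
    have "pi * (50 * L) \<le> pi * \<tau>" using assms by (intro mult_left_mono) auto
    \<comment> \<open>Reflection at pi / 2 exchanges the two tails, so the same bound applies to the
      lower tail \<tau>.\<close>
    moreover have "(pi - \<phi>) - sin (pi - \<phi>) * cos (pi - \<phi>) = pi * \<tau>" using g by (simp add: algebra_simps)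
    moreover have "(pi - \<phi>) - sin (pi - \<phi>) * cos (pi - \<phi>) \<le> 3 * sin (pi - \<phi>) ^ 3"
      using False \<phi> by (intro angle_defect_le_sin_cubed) auto
    moreover have "sin (pi - \<phi>) = sin \<phi>" by simp
    ultimately show ?thesis using pi by (metis (no_types, lifting) mult_le_cancel_left_pos order_trans zero_less_numeral)
  qed
  then have "sin \<phi> \<noteq> 0" using L_pos by auto
  then have "0 < \<phi>" "\<phi> < pi" using \<phi> by (auto simp: less_le)
  then show thesis using that s cdf by blast
qed

text \<open>For L > 1/110 the bound exceeds 1. Otherwise \<open>y\<close> is compared with a
  quantile on the required side of it: moving there costs at most 51 L and the estimate at the
  quantile 34 L.\<close>

lemma berry_esseen: "\<bar>N.prob {..<sqrt (real n) * y} - semicircle_cdf y\<bar> \<le> 110 * L"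
proof (cases "L \<le> 1 / 110")
  case False
  moreover have "\<bar>N.prob {..<sqrt (real n) * y} - semicircle_cdf y\<bar> \<le> 1"
    using semicircle_cdf_bounds[of y] by (smt (verit) N.prob_le_1 measure_nonneg)
  ultimately show ?thesis by simp
next
  case small: True
  let ?r = "sqrt (real n)"
  have r: "?r > 0" using n_ge_1 by simp
  note L0 = L_pos and wb = semicircle_cdf_bounds[of y]
  have lower: "semicircle_cdf y - 110 * L \<le> N.prob {..<?r * y}"
  proof (cases "semicircle_cdf y \<le> 51 * L")
    case True
    then show ?thesis using L0 by (smt (verit) measure_nonneg)
  next
    case False
    \<comment> \<open>Lowering by L puts the quantile strictly below \<open>y\<close>, so its closed
      half-line lies in the open one of \<open>y\<close>; the cap at 1 - 50 L keeps it off the upper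
      edge.\<close>
    define \<tau> where "\<tau> = min (semicircle_cdf y - L) (1 - 50 * L)"
    have "50 * L \<le> \<tau>" "\<tau> \<le> 1 - 50 * L" using False small by (auto simp: \<tau>_def)
    then obtain \<phi> where \<phi>: "0 < \<phi>" "\<phi> < pi" "50 * L \<le> sin \<phi> ^ 3" "semicircle_cdf (2 * cos \<phi>) = \<tau>"
      by (rule semicircle_quantile)
    have "\<tau> < semicircle_cdf y" using L0 by (auto simp: \<tau>_def)
    then have "2 * cos \<phi> < y" using mono_semicircle_cdf[of y "2 * cos \<phi>"] \<phi>(4) by (smt (verit))
    then have "?r * (2 * cos \<phi>) < ?r * y" using r by simp
    then have "N.prob {..?r * (2 * cos \<phi>)} \<le> N.prob {..<?r * y}"
      by (intro N.finite_measure_mono) auto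
    moreover have "semicircle_cdf y - 51 * L \<le> \<tau>" using wb L0 by (auto simp: \<tau>_def)
    ultimately show ?thesis using cdf_semicircle_approx(1)[OF \<phi>(1-3)] \<phi>(4) L0 by linarith
  qed
  have upper: "N.prob {..<?r * y} \<le> semicircle_cdf y + 110 * L"
  proof (cases "semicircle_cdf y \<ge> 1 - 51 * L")
    case True
    then show ?thesis using L0 N.prob_le_1[of "{..<?r * y}"] by linarith
  next
    case False
    \<comment> \<open>Mirror image: a quantile strictly above \<open>y\<close>, kept off the lower
      edge.\<close>
    define \<tau> where "\<tau> = max (semicircle_cdf y + L) (50 * L)"
    have "50 * L \<le> \<tau>" "\<tau> \<le> 1 - 50 * L" using False small by (auto simp: \<tau>_def)
    then obtain \<phi> where \<phi>: "0 < \<phi>" "\<phi> < pi" "50 * L \<le> sin \<phi> ^ 3" "semicircle_cdf (2 * cos \<phi>) = \<tau>"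
      by (rule semicircle_quantile)
    have "semicircle_cdf y < \<tau>" using L0 by (auto simp: \<tau>_def)
    then have "y < 2 * cos \<phi>" using mono_semicircle_cdf[of "2 * cos \<phi>" y] \<phi>(4) by (smt (verit))
    then have "?r * y < ?r * (2 * cos \<phi>)" using r by simp
    then have "N.prob {..<?r * y} \<le> N.prob {..<?r * (2 * cos \<phi>)}"
      by (intro N.finite_measure_mono) auto
    moreover have "\<tau> \<le> semicircle_cdf y + 51 * L" using wb L0 by (auto simp: \<tau>_def)
    ultimately show ?thesis using cdf_semicircle_approx(2)[OF \<phi>(1-3)] \<phi>(4) L0 by linarith
  qed
  show ?thesis using lower upper by (simp add: abs_le_iff)
qed

end

theorem corollary2p2:
  "\<exists>c::real. c > 0 \<and>
     (\<forall>(q::real) (\<mu>::real measure).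
        2 < q \<longrightarrow> q \<le> 3 \<longrightarrow>
        real_distribution \<mu> \<longrightarrow>
        integrable \<mu> (\<lambda>u. \<bar>u\<bar> powr q) \<longrightarrow>
        (\<integral>u. u \<partial>\<mu>) = 0 \<longrightarrow>
        (\<integral>u. u\<^sup>2 \<partial>\<mu>) = 1 \<longrightarrow>
        (\<forall>(n::nat) (\<rho>::real measure).
           n \<ge> 1 \<longrightarrow> is_free_convolution_power \<mu> n \<rho> \<longrightarrow>
           (SUP x::real. \<bar>measure \<rho> {..<sqrt (real n) * x} - semicircle_cdf x\<bar>)
             \<le> c * lyapunov_fraction q \<mu> n))"
proof (intro exI[of _ 110] conjI allI impI)
  fix q :: real and \<mu> :: "real measure" and n :: nat and \<rho> :: "real measure"
  assume *: "2 < q" "q \<le> 3" "real_distribution \<mu>" "integrable \<mu> (\<lambda>u. \<bar>u\<bar> powr q)"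
    "(\<integral>u. u \<partial>\<mu>) = 0" "(\<integral>u. u\<^sup>2 \<partial>\<mu>) = 1" "is_free_convolution_power \<mu> n \<rho>"
  \<comment> \<open>A non-integrable square would have integral 0 by convention, contradicting the
    value 1.\<close>
  have "integrable \<mu> (\<lambda>u. u\<^sup>2)"
    using *(6) not_integrable_integral_eq[of \<mu> "\<lambda>u. u\<^sup>2"] by force
  then interpret lyapunov_free_power \<mu> \<rho> n q
    using * by (simp add: lyapunov_free_power_def free_power_def standardized_distribution_def
        standardized_distribution_axioms_def free_power_axioms_def lyapunov_free_power_axioms_def)
  show "(SUP x::real. \<bar>measure \<rho> {..<sqrt (real n) * x} - semicircle_cdf x\<bar>) \<le> 110 * lyapunov_fraction q \<mu> n"
    by (rule cSUP_least) (use berry_esseen in auto)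
qed simp

end
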